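(* Let $T$ be an infinite undirected tree which is transient for simple random walk and which has no vertex of degree $2$. Let $T'=(V,E)$ be a bounded subdivision of $T$, and assign i.i.d. Exponential$(1)$ weights $(U_{\vec e})_{\vec e\in\vec E}$ to the oriented edges of $T'$. Then the wired MSA limit in $T'$ exists almost surely.
   Context: For an undirected graph $G=(V,E)$ (locally finite, connected, multiple edges allowed, no self-loops), $\vec E$ denotes the set of oriented edges obtained by giving each edge of $E$ both of its orientations; $\vec e_-$ is the tail and $\vec e_+$ the head of $\vec e$. For a finite such graph and a distinguished vertex $\partial$ (the boundary), a spanning arborescence of $(G,\partial)$ is a set of oriented edges containing no oriented cycle, in which every vertex other than $\partial$ has exactly one outgoing edge and $\partial$ has none. Given nonnegative weights on $\vec E$ drawn i.i.d. from a continuous distribution, the minimal spanning arborescence (MSA) of $(G,\partial)$ is the (a.s. unique) spanning arborescence minimizing the total weight of its edges. For infinite $G$: an exhaustion is a sequence of finite subgraphs $G_1\subset G_2\subset\cdots$ with $\bigcup_i G_i=G$; $G_i^{\mathsf w}$ is obtained from $G$ by identifying all vertices not in $G_i$ into a single vertex $\partial_i$ and erasing self-loops (oriented edges keep their weights); $T_i$ is the MSA of $(G_i^{\mathsf w},\partial_i)$. We say $T_i$ converges a.s. if for every vertex $v$ of $G$, almost surely the outgoing edge from $v$ in $T_i$ is the same for all sufficiently large $i$. If this holds and the limit does not depend (a.s.) on the choice of exhaustion, we say the wired MSA limit exists almost surely. A subdivision of a graph replaces each edge by a path of finite length; it is bounded if there is $M$ such that every such path has length at most $M$. *)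

theory Defs
  imports "HOL-Probability.Probability"
begin

section \<open>Graphs given by a vertex set and a symmetric irreflexive adjacency relation\<close>

definition simple_graph :: "'a set \<Rightarrow> ('a \<Rightarrow> 'a \<Rightarrow> bool) \<Rightarrow> bool" where
  "simple_graph V adj \<longleftrightarrow>
     (\<forall>u v. adj u v \<longrightarrow> u \<in> V \<and> v \<in> V \<and> u \<noteq> v \<and> adj v u)"

definition locally_finite_graph :: "'a set \<Rightarrow> ('a \<Rightarrow> 'a \<Rightarrow> bool) \<Rightarrow> bool" where
  "locally_finite_graph V adj \<longleftrightarrow> (\<forall>v\<in>V. finite {u. adj v u})"

definition degree :: "('a \<Rightarrow> 'a \<Rightarrow> bool) \<Rightarrow> 'a \<Rightarrow> nat" where
  "degree adj v = card {u. adj v u}"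

definition connected_graph :: "'a set \<Rightarrow> ('a \<Rightarrow> 'a \<Rightarrow> bool) \<Rightarrow> bool" where
  "connected_graph V adj \<longleftrightarrow> (\<forall>u\<in>V. \<forall>v\<in>V. (u, v) \<in> {(a, b). adj a b}\<^sup>*)"

text \<open>A cycle: at least 3 distinct vertices, consecutive ones adjacent, last adjacent to first.\<close>
definition has_cycle :: "('a \<Rightarrow> 'a \<Rightarrow> bool) \<Rightarrow> bool" where
  "has_cycle adj \<longleftrightarrow> (\<exists>xs. length xs \<ge> 3 \<and> distinct xs \<and>
      (\<forall>i. Suc i < length xs \<longrightarrow> adj (xs ! i) (xs ! Suc i)) \<and> adj (last xs) (hd xs))"

definition is_tree :: "'a set \<Rightarrow> ('a \<Rightarrow> 'a \<Rightarrow> bool) \<Rightarrow> bool" where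
  "is_tree V adj \<longleftrightarrow> simple_graph V adj \<and> V \<noteq> {} \<and> connected_graph V adj \<and> \<not> has_cycle adj"

section \<open>Transience of simple random walk\<close>

text \<open>Walks of length n from r back to r that do not visit r in between (first-return walks).\<close>
definition first_return_walks :: "('a \<Rightarrow> 'a \<Rightarrow> bool) \<Rightarrow> 'a \<Rightarrow> nat \<Rightarrow> 'a list set" where
  "first_return_walks adj r n = {xs. length xs = Suc n \<and> xs ! 0 = r \<and> xs ! n = r \<and>
      (\<forall>i<n. adj (xs ! i) (xs ! Suc i)) \<and> (\<forall>i. 0 < i \<and> i < n \<longrightarrow> xs ! i \<noteq> r)}"

text \<open>Probability that simple random walk started at r ever returns to r: the sum, over all
  first-return walks, of the probability of the walk under SRW (product of 1/deg).\<close>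
definition return_prob :: "('a \<Rightarrow> 'a \<Rightarrow> bool) \<Rightarrow> 'a \<Rightarrow> real" where
  "return_prob adj r = (\<Sum>n. \<Sum>xs\<in>first_return_walks adj r (Suc n).
       \<Prod>i<Suc n. 1 / real (degree adj (xs ! i)))"

definition srw_transient :: "'a set \<Rightarrow> ('a \<Rightarrow> 'a \<Rightarrow> bool) \<Rightarrow> bool" where
  "srw_transient V adj \<longleftrightarrow> (\<forall>r\<in>V.
     summable (\<lambda>n. \<Sum>xs\<in>first_return_walks adj r (Suc n).
                     \<Prod>i<Suc n. 1 / real (degree adj (xs ! i)))
     \<and> return_prob adj r < 1)"

section \<open>Bounded subdivisions\<close>

text \<open>(V, adj) arises from (VT, adjT) by replacing every edge {x,y} by a path p x y
  (from phi x to phi y) of length between 1 and M; new (interior) vertices are distinct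
  from the original ones and interiors of paths of different edges are disjoint.\<close>
definition subdivision_bounded_by ::
  "nat \<Rightarrow> 'a set \<Rightarrow> ('a \<Rightarrow> 'a \<Rightarrow> bool) \<Rightarrow> 'v set \<Rightarrow> ('v \<Rightarrow> 'v \<Rightarrow> bool) \<Rightarrow> bool" where
  "subdivision_bounded_by M VT adjT V adj \<longleftrightarrow>
    (\<exists>(\<phi> :: 'a \<Rightarrow> 'v) (p :: 'a \<Rightarrow> 'a \<Rightarrow> 'v list).
      inj_on \<phi> VT \<and> \<phi> ` VT \<subseteq> V \<and>
      (\<forall>x y. adjT x y \<longrightarrow>
         2 \<le> length (p x y) \<and> length (p x y) \<le> Suc M \<and>
         hd (p x y) = \<phi> x \<and> last (p x y) = \<phi> y \<and> distinct (p x y) \<and> set (p x y) \<subseteq> V \<and>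
         set (butlast (tl (p x y))) \<inter> \<phi> ` VT = {} \<and> p y x = rev (p x y)) \<and>
      (\<forall>x y x' y'. adjT x y \<longrightarrow> adjT x' y' \<longrightarrow> {x, y} \<noteq> {x', y'} \<longrightarrow>
         set (butlast (tl (p x y))) \<inter> set (butlast (tl (p x' y'))) = {}) \<and>
      (\<forall>a b. adj a b \<longleftrightarrow>
         (\<exists>x y i. adjT x y \<and> Suc i < length (p x y) \<and> a = p x y ! i \<and> b = p x y ! Suc i)) \<and>
      V = \<phi> ` VT \<union> (\<Union>{set (p x y) | x y. adjT x y}))"

definition bounded_subdivision ::
  "'a set \<Rightarrow> ('a \<Rightarrow> 'a \<Rightarrow> bool) \<Rightarrow> 'v set \<Rightarrow> ('v \<Rightarrow> 'v \<Rightarrow> bool) \<Rightarrow> bool" where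
  "bounded_subdivision VT adjT V adj \<longleftrightarrow> (\<exists>M. subdivision_bounded_by M VT adjT V adj)"

section \<open>Minimal spanning arborescences of the wired graphs\<close>

text \<open>Oriented edges of G are pairs (u,v) with adj u v. The wired graph for a finite vertex set Vi
  identifies V - Vi to a single vertex \<partial>; its oriented edges are exactly the oriented edges
  of G with tail in Vi (edges with both ends outside Vi become erased self-loops; those with
  tail outside Vi leave \<partial>). A spanning arborescence of (G^w, \<partial>) is thus a set A of oriented
  edges of G with tails in Vi, exactly one outgoing edge from each vertex of Vi, and no oriented
  cycle (a cycle cannot pass through \<partial>, which has no outgoing edge).\<close>
definition spanning_arb :: "('v \<Rightarrow> 'v \<Rightarrow> bool) \<Rightarrow> 'v set \<Rightarrow> ('v \<times> 'v) set \<Rightarrow> bool" where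
  "spanning_arb adj Vi A \<longleftrightarrow>
     A \<subseteq> {(u, v). adj u v} \<and> A \<subseteq> Vi \<times> UNIV \<and>
     (\<forall>v\<in>Vi. \<exists>!u. (v, u) \<in> A) \<and> acyclic (A \<inter> (Vi \<times> Vi))"

definition is_MSA :: "('v \<Rightarrow> 'v \<Rightarrow> bool) \<Rightarrow> ('v \<times> 'v \<Rightarrow> real) \<Rightarrow> 'v set \<Rightarrow> ('v \<times> 'v) set \<Rightarrow> bool" where
  "is_MSA adj w Vi A \<longleftrightarrow> spanning_arb adj Vi A \<and>
     (\<forall>B. spanning_arb adj Vi B \<longrightarrow> sum w A \<le> sum w B)"

definition exhaustion :: "'v set \<Rightarrow> (nat \<Rightarrow> 'v set) \<Rightarrow> bool" where
  "exhaustion V Vs \<longleftrightarrow> (\<forall>i. finite (Vs i) \<and> Vs i \<subseteq> V) \<and> incseq Vs \<and> (\<Union>i. Vs i) = V"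

text \<open>The outgoing edge from v in the MSA T_i equals (v,u) for all sufficiently large i.\<close>
definition MSA_eventually_out ::
  "('v \<Rightarrow> 'v \<Rightarrow> bool) \<Rightarrow> ('v \<times> 'v \<Rightarrow> real) \<Rightarrow> (nat \<Rightarrow> 'v set) \<Rightarrow> 'v \<Rightarrow> 'v \<Rightarrow> bool" where
  "MSA_eventually_out adj w Vs v u \<longleftrightarrow>
     eventually (\<lambda>i. \<forall>A. is_MSA adj w (Vs i) A \<longrightarrow> (v, u) \<in> A) sequentially"

definition wired_MSA_limit_exists ::
  "'v set \<Rightarrow> ('v \<Rightarrow> 'v \<Rightarrow> bool) \<Rightarrow> ('v \<times> 'v \<Rightarrow> real) measure \<Rightarrow> bool" where
  "wired_MSA_limit_exists V adj M \<longleftrightarrow>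
     (\<forall>Vs. exhaustion V Vs \<longrightarrow>
        (\<forall>v\<in>V. AE w in M. \<exists>u. MSA_eventually_out adj w Vs v u)) \<and>
     (\<forall>Vs Ws. exhaustion V Vs \<longrightarrow> exhaustion V Ws \<longrightarrow>
        (\<forall>v\<in>V. AE w in M. \<forall>u u'. MSA_eventually_out adj w Vs v u \<longrightarrow>
                                   MSA_eventually_out adj w Ws v u' \<longrightarrow> u = u'))"

text \<open>I.i.d. Exponential(1) weights on the oriented edges.\<close>
definition exp_weights :: "('v \<Rightarrow> 'v \<Rightarrow> bool) \<Rightarrow> ('v \<times> 'v \<Rightarrow> real) measure" where
  "exp_weights adj = PiM {(u, v). adj u v} (\<lambda>_. density lborel (exponential_density 1))"

end

theory Submission
  imports Defs
begin

text \<open>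
  Let \<open>q v u\<close> be the increase of the optimal total weight when the vertex \<open>v\<close>, without an
  outgoing edge before, has to point to its neighbour \<open>u\<close>. On a tree it satisfies
  \<open>q v u = w (v, u) + max 0 (min {q u c | c \<noteq> v} - w (u, v))\<close>,
  where the recursion starts from \<open>w (v, u)\<close> at the boundary. Its value increases with
  the finite subgraph, so the outgoing edge of \<open>v\<close>, which minimises \<open>q v u\<close> over \<open>u\<close>, converges as
  soon as some limit \<open>q v u\<close> is finite and the minimum is attained once. Ties have probability
  zero since \<open>w (v, u)\<close> is continuous and independent of all the rest.

  Finiteness of some \<open>q r u \<le> K\<close> means that along some ray from \<open>r\<close> a budget, initially \<open>K\<close>,
  survives when every edge \<open>(x, y)\<close> of the ray first costs \<open>w (x, y)\<close> and then pays back \<open>w (y, x)\<close>. For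
  exponential weights the budget itself, set to zero at ruin, is a martingale with increments of variance at
  most 2. Averaging the budgets of level \<open>n\<close> with a unit flow \<open>\<theta>\<close> gives a martingale of mean \<open>K\<close>
  and second moment at most \<open>K\<^sup>2 + 2 E\<close>, where \<open>E\<close> is the energy of \<open>\<theta>\<close>. Hence a ray survives
  with probability at least \<open>K\<^sup>2 / (K\<^sup>2 + 2 E)\<close>, which tends to 1 as \<open>K\<close> grows. Transience provides
  a flow of finite energy, and a subdivision into paths of length at most \<open>M\<close> multiplies
  the energy at most by \<open>M\<close>.
\<close>

section \<open>Rooted trees\<close>

text \<open>Setting the budget to zero at ruin costs nothing on average because exponential weights
  are memoryless: given \<open>a \<ge> W\<close>, the shortfall \<open>a - W\<close> is again
  Exponential(1), so the discarded value \<open>W - a + b\<close> has conditional mean -1 + 1 = 0.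
  Budgets on one level share the edges near the root and are not independent. Their increments at
  different vertices are nevertheless orthogonal, since each is driven by the two weights on its own
  edge; this is how the energy of the flow enters the second moment. Independence is used by
  resampling single coordinates, which replaces conditional expectations. The flow starts at one
  root, whereas the limit is asserted at every vertex. A finite escape cost passes from a vertex to
  its neighbours, and rerooting then makes any vertex the root, so that only the choice made at the
  root has to be analysed.\<close>

locale rooted_tree =
  fixes V :: "'v set" and adj :: "'v \<Rightarrow> 'v \<Rightarrow> bool" and r :: 'v and par :: "'v \<Rightarrow> 'v"
  assumes root_in: "r \<in> V"
    and adj_iff: "adj x y \<longleftrightarrow> x \<in> V \<and> y \<in> V \<and> (x \<noteq> r \<and> y = par x \<or> y \<noteq> r \<and> x = par y)"
    and par_in: "x \<in> V \<Longrightarrow> x \<noteq> r \<Longrightarrow> par x \<in> V"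
    and reach: "x \<in> V \<Longrightarrow> \<exists>n. (par ^^ n) x = r"
    and finite_nbrs: "x \<in> V \<Longrightarrow> finite {y. adj x y}"
begin

text \<open>The least exponent matters: \<open>par r\<close> is arbitrary, so iterates may leave the
  root again after reaching it.\<close>

definition depth :: "'v \<Rightarrow> nat" where
  "depth x = (LEAST n. (par ^^ n) x = r)"

definition ch :: "'v \<Rightarrow> 'v set" where
  "ch x = {c \<in> V. c \<noteq> r \<and> par c = x}"

definition level :: "nat \<Rightarrow> 'v set" where
  "level n = {x \<in> V. depth x = n}"

lemma depth_root [simp]: "depth r = 0"
  unfolding depth_def by (rule Least_eq_0) simp

lemma depth_par:
  assumes "x \<in> V" "x \<noteq> r"
  shows "depth x = Suc (depth (par x))"
proof -
  obtain n where "(par ^^ n) x = r" using reach assms by blast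
  then show ?thesis
    unfolding depth_def using assms
    by (subst Least_Suc[of _ n]) (auto simp: funpow_Suc_right simp del: funpow.simps(2))
qed

lemma depth_0_iff: "x \<in> V \<Longrightarrow> depth x = 0 \<longleftrightarrow> x = r"
  using depth_par by fastforce

lemma chD: "c \<in> ch x \<Longrightarrow> c \<in> V \<and> c \<noteq> r \<and> par c = x \<and> x \<in> V \<and> depth c = Suc (depth x)"
  unfolding ch_def using par_in depth_par by auto

lemma ch_adj: "c \<in> ch x \<Longrightarrow> adj x c \<and> adj c x"
  using chD adj_iff by blast

lemma adj_sym: "adj x y \<Longrightarrow> adj y x"
  by (auto simp: adj_iff)

lemma adj_in: "adj x y \<Longrightarrow> x \<in> V \<and> y \<in> V"
  by (auto simp: adj_iff)

lemma finite_nbrs': "finite {y. adj x y}"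
  using finite_nbrs adj_in by (metis (no_types, lifting) empty_Collect_eq finite.emptyI)

lemma adj_neq: "adj x y \<Longrightarrow> x \<noteq> y"
  using adj_iff depth_par by (metis n_not_Suc_n)

lemma adj_cases: "adj x y \<Longrightarrow> (x \<noteq> r \<and> y = par x) \<or> y \<in> ch x"
  by (auto simp: adj_iff ch_def)

lemma adj_ch: "adj x y \<Longrightarrow> x = r \<or> y \<noteq> par x \<Longrightarrow> y \<in> ch x"
  by (auto simp: adj_iff ch_def)

lemma ch_root: "ch r = {y. adj r y}"
  using adj_cases ch_adj by blast

lemma nbrs_eq: "x \<in> V \<Longrightarrow> x \<noteq> r \<Longrightarrow> {y. adj x y} = insert (par x) (ch x)"
  using adj_cases ch_adj adj_iff par_in by auto

lemma par_notin_ch: "x \<in> V \<Longrightarrow> x \<noteq> r \<Longrightarrow> par x \<notin> ch x"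
  using chD depth_par by fastforce

lemma finite_ch: "finite (ch x)"
proof (cases "x \<in> V")
  case True
  then show ?thesis using finite_nbrs ch_adj by (metis (no_types, lifting) finite_subset mem_Collect_eq subsetI)
next
  case False
  then have "ch x = {}" using chD by blast
  then show ?thesis by simp
qed

lemma level_0: "level 0 = {r}"
  using depth_0_iff root_in by (auto simp: level_def)

lemma level_Suc: "level (Suc n) = (\<Union>x\<in>level n. ch x)"
proof (intro subset_antisym subsetI)
  fix c assume "c \<in> level (Suc n)"
  then have c: "c \<in> V" "depth c = Suc n" by (auto simp: level_def)
  then have "c \<noteq> r" by auto
  then show "c \<in> (\<Union>x\<in>level n. ch x)"
    using c depth_par[of c] par_in[of c] by (auto simp: level_def ch_def)
next
  fix c assume "c \<in> (\<Union>x\<in>level n. ch x)"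
  then show "c \<in> level (Suc n)" using chD by (fastforce simp: level_def)
qed

lemma finite_level: "finite (level n)"
  by (induction n) (auto simp: level_0 level_Suc finite_ch)

lemma sum_level_Suc: "(\<Sum>c\<in>level (Suc n). F c) = (\<Sum>x\<in>level n. \<Sum>c\<in>ch x. F c)"
  unfolding level_Suc
  by (rule sum.UNION_disjoint) (auto simp: finite_level finite_ch dest: chD)

lemma finite_ball: "finite {x \<in> V. depth x \<le> n}"
proof -
  have "{x \<in> V. depth x \<le> n} = (\<Union>k\<le>n. level k)" by (auto simp: level_def)
  then show ?thesis by (simp add: finite_level)
qed

lemma countable_V: "countable V"
proof -
  have "V = (\<Union>k. level k)" by (auto simp: level_def)
  then show ?thesis using finite_level by (metis countable_UN countable_finite countableI_type)
qed

lemma countable_edges: "countable {(u, v). adj u v}"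
proof -
  have "{(u, v). adj u v} \<subseteq> V \<times> V" using adj_in by auto
  then show ?thesis using countable_V by (meson countable_SIGMA countable_subset)
qed

text \<open>Take a deepest vertex \<open>b\<close> among those that lie on closed walks through
  \<open>a\<close>. Its successor and its predecessor there are not deeper, so both are the parent
  of \<open>b\<close>, and one edge is used in both directions.\<close>

lemma acyclic_if_no_2_cycles:
  assumes fin: "finite S" and A: "A \<subseteq> {(u, v). adj u v}"
    and no2: "\<And>x y. (x, y) \<in> A \<Longrightarrow> (y, x) \<notin> A"
  shows "acyclic (A \<inter> (S \<times> S))"
proof (rule acyclicI, rule allI, rule notI)
  let ?R = "A \<inter> (S \<times> S)"
  fix a assume a: "(a, a) \<in> ?R\<^sup>+"
  let ?C = "{b. (a, b) \<in> ?R\<^sup>+ \<and> (b, a) \<in> ?R\<^sup>+}"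
  have "?C \<subseteq> S"
    by (auto dest: tranclD)
  then have finC: "finite ?C" using fin finite_subset by blast
  moreover have neC: "?C \<noteq> {}" using a by blast
  ultimately have "Max (depth ` ?C) \<in> depth ` ?C"
    by (intro Max_in) auto
  then obtain b where b: "b \<in> ?C" "depth b = Max (depth ` ?C)" by auto
  have bmax: "depth c \<le> depth b" if "c \<in> ?C" for c
    unfolding b(2) using that finC by (intro Max_ge) auto
  have bb: "(b, b) \<in> ?R\<^sup>+" using b by (auto intro: trancl_trans)
  obtain s where s: "(b, s) \<in> ?R" "(s, b) \<in> ?R\<^sup>*" using tranclD[OF bb] by blast
  obtain t where t: "(t, b) \<in> ?R" "(b, t) \<in> ?R\<^sup>*" using tranclD2[OF bb] by blast
  have sC: "s \<in> ?C"
    using b s by (auto intro: trancl_into_trancl rtrancl_trancl_trancl)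
  have tC: "t \<in> ?C"
    using b t by (auto intro: trancl_into_trancl2 trancl_rtrancl_trancl)
  have "adj b s" "adj b t" using s t A adj_sym by auto
  then have "s = par b" "t = par b"
    using bmax[OF sC] bmax[OF tC] adj_cases chD by fastforce+
  then show False using no2 s t by blast
qed

text \<open>Only one pointer changes: the old root now points to \<open>s\<close>. The old value at
  \<open>s\<close> may stay, because the locale does not constrain the parent of the root.\<close>

lemma reroot_nbr:
  assumes "adj r s"
  shows "\<exists>par'. rooted_tree V adj s par'"
proof -
  have s: "s \<in> V" "s \<noteq> r" "par s = r" using assms by (auto simp: adj_iff)
  let ?par' = "par(r := s)"
  have r1: "\<exists>n. (?par' ^^ n) x = r" if "x \<in> V" for x
    using that
  proof (induction "depth x" arbitrary: x rule: less_induct)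
    case less
    show ?case
    proof (cases "x = r")
      case True
      then show ?thesis by (intro exI[of _ 0]) simp
    next
      case False
      then have "depth (par x) < depth x" "par x \<in> V" using less depth_par par_in by auto
      then obtain n where "(?par' ^^ n) (par x) = r" using less by blast
      then have "(?par' ^^ Suc n) x = r" using False by (simp add: funpow_Suc_right del: funpow.simps(2))
      then show ?thesis by blast
    qed
  qed
  have "rooted_tree V adj s ?par'"
  proof
    show "s \<in> V" by fact
    show "adj x y \<longleftrightarrow> x \<in> V \<and> y \<in> V \<and> (x \<noteq> s \<and> y = ?par' x \<or> y \<noteq> s \<and> x = ?par' y)" for x y
      unfolding adj_iff using s by auto
    show "?par' x \<in> V" if "x \<in> V" "x \<noteq> s" for x using that s par_in by auto
    show "finite {y. adj x y}" if "x \<in> V" for x using that finite_nbrs by blast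
    fix x assume "x \<in> V"
    then obtain n where "(?par' ^^ n) x = r" using r1 by blast
    then have "(?par' ^^ Suc n) x = s" by simp
    then show "\<exists>n. (?par' ^^ n) x = s" by blast
  qed
  then show ?thesis by blast
qed

lemma reachable: "x \<in> V \<Longrightarrow> (r, x) \<in> {(a, b). adj a b}\<^sup>*"
proof (induction "depth x" arbitrary: x rule: less_induct)
  case less
  show ?case
  proof (cases "x = r")
    case False
    then have "depth (par x) < depth x" "par x \<in> V" "adj (par x) x"
      using less depth_par par_in by (auto simp: adj_iff)
    then show ?thesis using less by (auto intro: rtrancl_into_rtrancl)
  qed auto
qed

lemma reroot:
  assumes "s \<in> V"
  shows "\<exists>par'. rooted_tree V adj s par'"
  using reachable[OF assms]
proof (induction rule: rtrancl_induct)
  case base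
  then show ?case using rooted_tree_axioms by blast
next
  case (step y z)
  then show ?case using rooted_tree.reroot_nbr by fastforce
qed

end

section \<open>Escape costs and exchanges in arborescences\<close>

text \<open>Write \<open>q n v u\<close> for the increase of the optimal total weight when \<open>v\<close>, without an outgoing
  edge before, has to point to \<open>u\<close>, and everything beyond distance \<open>n\<close> is wired; then
  \<open>q (n+1) v u = w (v, u) + max 0 (min {q n u c | c} - w (u, v))\<close>.  The predicate below
  expresses \<open>q n v u \<le> t\<close>, which avoids infinite values.\<close>

fun escape_le :: "('v \<Rightarrow> 'v \<Rightarrow> bool) \<Rightarrow> ('v \<times> 'v \<Rightarrow> real) \<Rightarrow> nat \<Rightarrow> 'v \<Rightarrow> 'v \<Rightarrow> real \<Rightarrow> bool" where
  "escape_le adj w 0 v u t \<longleftrightarrow> w (v, u) \<le> t"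
| "escape_le adj w (Suc n) v u t \<longleftrightarrow> w (v, u) \<le> t \<and>
     (\<exists>c. adj u c \<and> c \<noteq> v \<and> escape_le adj w n u c (t - w (v, u) + w (u, v)))"

definition escape_le_all ::
  "('v \<Rightarrow> 'v \<Rightarrow> bool) \<Rightarrow> ('v \<times> 'v \<Rightarrow> real) \<Rightarrow> 'v \<Rightarrow> 'v \<Rightarrow> real \<Rightarrow> bool" where
  "escape_le_all adj w v u t \<longleftrightarrow> (\<forall>n. escape_le adj w n v u t)"

definition can_escape :: "('v \<Rightarrow> 'v \<Rightarrow> bool) \<Rightarrow> ('v \<times> 'v \<Rightarrow> real) \<Rightarrow> 'v \<Rightarrow> bool" where
  "can_escape adj w v \<longleftrightarrow> (\<exists>u t. adj v u \<and> escape_le_all adj w v u t)"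

lemma escape_le_mono: "escape_le adj w n v u s \<Longrightarrow> s \<le> t \<Longrightarrow> escape_le adj w n v u t"
proof (induction n arbitrary: v u s t)
  case (Suc n)
  then obtain c where "adj u c" "c \<noteq> v" "escape_le adj w n u c (s - w (v, u) + w (u, v))" by auto
  then show ?case using Suc by fastforce
qed auto

lemma escape_le_SucD: "escape_le adj w (Suc n) v u t \<Longrightarrow> escape_le adj w n v u t"
proof (induction n arbitrary: v u t)
  case (Suc n)
  then show ?case by (metis escape_le.simps(2))
qed auto

lemma escape_le_antimono: "m \<le> n \<Longrightarrow> escape_le adj w n v u t \<Longrightarrow> escape_le adj w m v u t"
  by (induction n rule: dec_induct) (simp, metis escape_le_SucD)

lemma escape_le_all_mono: "escape_le_all adj w v u s \<Longrightarrow> s \<le> t \<Longrightarrow> escape_le_all adj w v u t"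
  unfolding escape_le_all_def using escape_le_mono by fast

text \<open>A compactness argument: the condition weakens as \<open>n\<close> decreases and there
  are finitely many candidates \<open>c\<close>, so one of them serves every depth. The recursion
  thus survives in the limit.\<close>

lemma escape_le_all_iff:
  assumes fin: "finite {c. adj u c}"
  shows "escape_le_all adj w v u t \<longleftrightarrow> w (v, u) \<le> t \<and>
     (\<exists>c. adj u c \<and> c \<noteq> v \<and> escape_le_all adj w u c (t - w (v, u) + w (u, v)))"
    (is "?L \<longleftrightarrow> ?R")
proof
  let ?s = "t - w (v, u) + w (u, v)"
  assume L: ?L
  have "\<exists>c\<in>{c. adj u c \<and> c \<noteq> v}. \<forall>n. escape_le adj w n u c ?s"
  proof (rule ccontr)
    assume "\<not> ?thesis"
    then have "\<forall>c\<in>{c. adj u c \<and> c \<noteq> v}. \<exists>n. \<not> escape_le adj w n u c ?s" by blast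
    from bchoice[OF this] obtain N where
      N: "\<And>c. adj u c \<Longrightarrow> c \<noteq> v \<Longrightarrow> \<not> escape_le adj w (N c) u c ?s"
      by blast
    let ?m = "Max (N ` {c. adj u c})"
    obtain c where c: "adj u c" "c \<noteq> v" "escape_le adj w ?m u c ?s"
      using L unfolding escape_le_all_def by (metis escape_le.simps(2))
    have "N c \<le> ?m" using c fin by auto
    then show False using N c escape_le_antimono by metis
  qed
  moreover have "w (v, u) \<le> t" using L unfolding escape_le_all_def by (metis escape_le.simps(1))
  ultimately show ?R by (auto simp: escape_le_all_def)
next
  assume ?R
  then have "escape_le adj w n v u t" for n
    by (cases n) (auto simp: escape_le_all_def)
  then show ?L by (simp add: escape_le_all_def)
qed

section \<open>Escape at neighbouring vertices, and exchange arguments for arborescences of a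
  tree\<close>

context rooted_tree
begin

text \<open>Either the escape from \<open>v\<close> goes through \<open>u\<close>, and its
  continuation escapes from \<open>u\<close>, or \<open>u\<close> steps to \<open>v\<close> first
  and then follows the escape from \<open>v\<close>, which does not backtrack.\<close>

lemma can_escape_nbr:
  assumes v: "can_escape adj w v" and a: "adj v u"
  shows "can_escape adj w u"
proof -
  obtain z t where z: "adj v z" "escape_le_all adj w v z t"
    using v unfolding can_escape_def by blast
  show ?thesis
  proof (cases "z = u")
    case True
    then show ?thesis
      using z escape_le_all_iff[of adj u] finite_nbrs adj_in unfolding can_escape_def by blast
  next
    case False
    \<comment> \<open>The first argument of \<open>max\<close> pays for the edge to
      \<open>v\<close>; the second leaves a bound of at least \<open>t\<close> at \<open>v\<close>
      after the payback \<open>w (v, u)\<close>.\<close>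
    have "escape_le_all adj w u v (max (w (u, v)) (t + w (u, v) - w (v, u)))"
      using z False adj_in[OF a] finite_nbrs
      by (subst escape_le_all_iff) (auto intro!: exI[of _ z] elim: escape_le_all_mono)
    then show ?thesis using adj_sym[OF a] unfolding can_escape_def by blast
  qed
qed

lemma can_escape_all:
  assumes "can_escape adj w r" "x \<in> V"
  shows "can_escape adj w x"
  using reachable[OF assms(2)]
  by (induction rule: rtrancl_induct) (use assms can_escape_nbr in auto)

text \<open>In a tree an arborescence is a choice of neighbours without reciprocal choices. The set
  \<open>S\<close> is the vertex set of the finite subgraph, or that set with one vertex removed.\<close>
definition valid_choice :: "'v set \<Rightarrow> ('v \<Rightarrow> 'v) \<Rightarrow> bool" where
  "valid_choice S f \<longleftrightarrow> (\<forall>x\<in>S. adj x (f x) \<and> (f x \<in> S \<longrightarrow> f (f x) \<noteq> x))"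

text \<open>If pointing to \<open>c\<close> costs more than \<open>t\<close>, giving up the outgoing
  edge of \<open>x\<close> must save more than \<open>t\<close>. Either dropping the edge is enough,
  or \<open>c\<close> is released first and then redirected up to \<open>x\<close>. The ball inside
  \<open>S\<close> guarantees that \<open>c\<close> has an outgoing edge to release. The clause on
  smaller depths is for the induction: releasing \<open>c\<close> must not change the edge from
  \<open>x\<close> to \<open>c\<close>.\<close>

lemma release_vertex:
  assumes "finite S" "valid_choice S f" "x \<in> S" "f x = c" "c \<in> ch x"
    and "\<not> escape_le adj w n x c t" "\<And>y. y \<in> V \<Longrightarrow> depth y < depth c + n \<Longrightarrow> y \<in> S"
  shows "\<exists>g. valid_choice (S - {x}) g \<and> (\<forall>y. depth y < depth x \<longrightarrow> g y = f y) \<and>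
    (\<Sum>y\<in>S - {x}. w (y, g y)) < (\<Sum>y\<in>S. w (y, f y)) - t"
  using assms
proof (induction n arbitrary: x c t)
  case 0
  then have "valid_choice (S - {x}) f" by (auto simp: valid_choice_def)
  moreover have "(\<Sum>y\<in>S. w (y, f y)) = w (x, c) + (\<Sum>y\<in>S - {x}. w (y, f y))"
    using 0 by (simp add: sum.remove)
  ultimately show ?case using 0 by (intro exI[of _ f]) auto
next
  case (Suc n)
  have remx: "(\<Sum>y\<in>S. w (y, f y)) = w (x, c) + (\<Sum>y\<in>S - {x}. w (y, f y))"
    using Suc.prems by (simp add: sum.remove)
  show ?case
  proof (cases "w (x, c) \<le> t")
    case False
    have "valid_choice (S - {x}) f" using Suc.prems by (auto simp: valid_choice_def)
    then show ?thesis using remx False by (intro exI[of _ f]) auto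
  next
    case True
    have c: "c \<in> V" "depth c = Suc (depth x)" "x \<noteq> c" "par c = x" "adj c x" "c \<noteq> r"
      using chD[OF Suc.prems(5)] ch_adj[OF Suc.prems(5)] by auto
    have cS: "c \<in> S" using Suc.prems(7) c by auto
    define c' where "c' = f c"
    have c': "adj c c'" "c' \<noteq> x"
      using Suc.prems(2-4) cS unfolding valid_choice_def c'_def by auto
    have c'ch: "c' \<in> ch c" using adj_ch[OF c'(1)] c' c by auto
    have "\<not> escape_le adj w n c c' (t - w (x, c) + w (c, x))"
      using Suc.prems(6) True c' by auto
    moreover have "depth c' = Suc (depth c)" using chD[OF c'ch] by simp
    ultimately obtain g where g: "valid_choice (S - {c}) g" "\<forall>y. depth y < depth c \<longrightarrow> g y = f y"
      "(\<Sum>y\<in>S - {c}. w (y, g y)) < (\<Sum>y\<in>S. w (y, f y)) - (t - w (x, c) + w (c, x))"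
      using Suc.IH[of c c' "t - w (x, c) + w (c, x)"] Suc.prems(1,2,7) cS c'_def c'ch by auto
    have gx: "g x = c" using g c Suc.prems by auto
    \<comment> \<open>The edge back to \<open>x\<close> closes no 2-cycle because \<open>x\<close>
      is no longer among the vertices that point anywhere. The saving is the one at
      \<open>c\<close>, plus \<open>w (x, c)\<close>, minus \<open>w (c, x)\<close>.\<close>
    let ?h = "g(c := x)"
    have vh: "valid_choice (S - {x}) ?h"
      using g(1) c unfolding valid_choice_def by auto
    have "(\<Sum>y\<in>S - {x}. w (y, ?h y)) = w (c, x) + (\<Sum>y\<in>S - {x} - {c}. w (y, g y))"
      using Suc.prems(1) cS c by (subst sum.remove[of _ c]) auto
    moreover have "(\<Sum>y\<in>S - {c}. w (y, g y)) = w (x, c) + (\<Sum>y\<in>S - {c} - {x}. w (y, g y))"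
      using Suc.prems(1,3) c gx by (subst sum.remove[of _ x]) auto
    moreover have "S - {c} - {x} = S - {x} - {c}" by auto
    then have "(\<Sum>y\<in>S - {c} - {x}. w (y, g y)) = (\<Sum>y\<in>S - {x} - {c}. w (y, g y))" by (rule arg_cong)
    ultimately have "(\<Sum>y\<in>S - {x}. w (y, ?h y)) < (\<Sum>y\<in>S. w (y, f y)) - t"
      using g(3) by linarith
    moreover have "\<forall>y. depth y < depth x \<longrightarrow> ?h y = f y" using g(2) c by simp
    ultimately show ?thesis using vh by blast
  qed
qed

text \<open>The converse exchange. The new edge from \<open>x\<close> to \<open>c\<close> conflicts
  only with an edge from \<open>c\<close> to \<open>x\<close>; in that case \<open>c\<close> loses
  its edge, which refunds \<open>w (c, x)\<close>, and is itself refilled further down. Here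
  \<open>S\<close> has to lie inside the ball, so that at depth 0 the vertex \<open>c\<close> is
  already on the boundary.\<close>

lemma fill_vertex:
  assumes "finite S" "valid_choice (S - {x}) g" "x \<in> S" "c \<in> ch x"
    and "escape_le adj w n x c t" "\<And>y. y \<in> S \<Longrightarrow> depth y < depth c + n"
  shows "\<exists>h. valid_choice S h \<and> (\<Sum>y\<in>S. w (y, h y)) \<le> (\<Sum>y\<in>S - {x}. w (y, g y)) + t"
  using assms
proof (induction n arbitrary: x c t g)
  case 0
  have c: "c \<in> V" "x \<noteq> c" "adj x c" using chD[OF 0(4)] ch_adj[OF 0(4)] by auto
  have "c \<notin> S" using 0(6)[of c] by auto
  then have "valid_choice S (g(x := c))" using 0(2) c unfolding valid_choice_def by auto
  moreover have "(\<Sum>y\<in>S. w (y, (g(x := c)) y)) = w (x, c) + (\<Sum>y\<in>S - {x}. w (y, g y))"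
    using 0 by (subst sum.remove[of _ x]) auto
  moreover have "w (x, c) \<le> t" using 0 by simp
  ultimately show ?case by (intro exI[of _ "g(x := c)"] conjI) (assumption, linarith)
next
  case (Suc n)
  have c: "c \<in> V" "x \<noteq> c" "adj x c" "par c = x" "c \<noteq> r" "depth c = Suc (depth x)"
    using chD[OF Suc.prems(4)] ch_adj[OF Suc.prems(4)] by auto
  let ?g = "g(x := c)"
  have cost: "(\<Sum>y\<in>S. w (y, ?g y)) = w (x, c) + (\<Sum>y\<in>S - {x}. w (y, g y))"
    using Suc.prems(1,3) by (subst sum.remove[of _ x]) auto
  show ?case
  proof (cases "c \<in> S \<and> g c = x")
    case False
    then have "valid_choice S ?g" using Suc.prems(2) c unfolding valid_choice_def by auto
    moreover have "w (x, c) \<le> t" using Suc.prems(5) by simp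
    ultimately show ?thesis using cost by (intro exI[of _ ?g] conjI) (assumption, linarith)
  next
    case True
    obtain c' where c': "adj c c'" "c' \<noteq> x" "escape_le adj w n c c' (t - w (x, c) + w (c, x))"
      using Suc.prems(5) by auto
    have c'ch: "c' \<in> ch c" using adj_ch[OF c'(1)] c' c by auto
    have v: "valid_choice (S - {c}) ?g"
      using Suc.prems(2) c True unfolding valid_choice_def by auto
    have "(\<Sum>y\<in>S. w (y, ?g y)) = w (c, x) + (\<Sum>y\<in>S - {c}. w (y, ?g y))"
      using Suc.prems(1) True c by (subst sum.remove[of _ c]) auto
    then show ?thesis
      using Suc.IH[of c ?g c' "t - w (x, c) + w (c, x)"] Suc.prems(1,6) v True c'ch c'(3) cost
        chD[OF c'ch] by fastforce
  qed
qed

lemma valid_choice_arb: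
  assumes "finite S" "valid_choice S f"
  shows "spanning_arb adj S ((\<lambda>x. (x, f x)) ` S)"
    and "sum w ((\<lambda>x. (x, f x)) ` S) = (\<Sum>x\<in>S. w (x, f x))"
proof -
  have "acyclic ((\<lambda>x. (x, f x)) ` S \<inter> S \<times> S)"
    by (rule acyclic_if_no_2_cycles) (use assms in \<open>auto simp: valid_choice_def\<close>)
  then show "spanning_arb adj S ((\<lambda>x. (x, f x)) ` S)"
    using assms by (auto simp: spanning_arb_def valid_choice_def)
  show "sum w ((\<lambda>x. (x, f x)) ` S) = (\<Sum>x\<in>S. w (x, f x))"
    by (subst sum.reindex) (auto simp: inj_on_def)
qed

lemma arb_valid_choice:
  assumes "spanning_arb adj S A"
  obtains f where "valid_choice S f" "A = (\<lambda>x. (x, f x)) ` S"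
proof -
  define f where "f x = (THE u. (x, u) \<in> A)" for x
  have f: "(x, u) \<in> A \<longleftrightarrow> u = f x" if "x \<in> S" for x u
  proof -
    have "\<exists>!u. (x, u) \<in> A" using assms that by (auto simp: spanning_arb_def)
    then show ?thesis unfolding f_def by (metis the_equality)
  qed
  have A: "A = (\<lambda>x. (x, f x)) ` S"
    using assms f by (auto simp: spanning_arb_def)
  have "f (f x) \<noteq> x" if "x \<in> S" "f x \<in> S" for x
  proof
    assume "f (f x) = x"
    then have "(x, f x) \<in> A \<inter> S \<times> S" "(f x, x) \<in> A \<inter> S \<times> S" using that f by auto
    then have "(x, x) \<in> (A \<inter> S \<times> S)\<^sup>+" by (meson trancl.r_into_trancl trancl_into_trancl)
    then show False using assms by (auto simp: spanning_arb_def acyclic_def)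
  qed
  moreover have "adj x (f x)" if "x \<in> S" for x
    using assms f that by (auto simp: spanning_arb_def)
  ultimately have "valid_choice S f" by (auto simp: valid_choice_def)
  then show ?thesis using that A by blast
qed

text \<open>If the root pointed to another neighbour, releasing it would save more than
  \<open>t\<close>, and refilling it towards \<open>u\<close> would cost at most \<open>t\<close>,
  contradicting minimality. Failure at the single depth \<open>n\<close> is enough for the other
  neighbours, whereas \<open>u\<close> needs a bound at every depth because \<open>S\<close> may be
  much larger than the ball.\<close>

lemma MSA_out_root:
  assumes fin: "finite S" and A: "is_MSA adj w S A" and ru: "adj r u"
    and esc: "escape_le_all adj w r u t"
    and nesc: "\<And>u'. adj r u' \<Longrightarrow> u' \<noteq> u \<Longrightarrow> \<not> escape_le adj w n r u' t"
    and ball: "\<And>y. y \<in> V \<Longrightarrow> depth y \<le> n \<Longrightarrow> y \<in> S"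
  shows "(r, u) \<in> A"
proof -
  have rS: "r \<in> S" using ball root_in by simp
  obtain f where f: "valid_choice S f" "A = (\<lambda>x. (x, f x)) ` S"
    using arb_valid_choice A unfolding is_MSA_def by blast
  have "f r = u"
  proof (rule ccontr)
    assume ne: "f r \<noteq> u"
    have a: "adj r (f r)" using f rS by (auto simp: valid_choice_def)
    have "\<exists>g. valid_choice (S - {r}) g \<and> (\<forall>y. depth y < depth r \<longrightarrow> g y = f y) \<and>
      (\<Sum>y\<in>S - {r}. w (y, g y)) < (\<Sum>y\<in>S. w (y, f y)) - t"
      by (rule release_vertex[where n = n and c = "f r"])
        (use a ne nesc ball fin f rS in \<open>auto simp: ch_root depth_par dest: adj_in\<close>,
         metis a ball ch_root chD depth_root less_Suc_eq_le add_Suc add_0 mem_Collect_eq)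
    then obtain g where g: "valid_choice (S - {r}) g"
      "(\<Sum>y\<in>S - {r}. w (y, g y)) < (\<Sum>y\<in>S. w (y, f y)) - t" by blast
    \<comment> \<open>The depth is chosen beyond all of \<open>S\<close>, so that the refilling
      certainly reaches the boundary.\<close>
    have "\<exists>h. valid_choice S h \<and> (\<Sum>y\<in>S. w (y, h y)) \<le> (\<Sum>y\<in>S - {r}. w (y, g y)) + t"
    proof (rule fill_vertex[where n = "Suc (Max (depth ` S))" and c = u])
      show "escape_le adj w (Suc (Max (depth ` S))) r u t"
        using esc unfolding escape_le_all_def by blast
      fix y assume "y \<in> S"
      then show "depth y < depth u + Suc (Max (depth ` S))"
        using fin by (meson Max_ge finite_imageI image_eqI le_imp_less_Suc trans_less_add2)
    qed (use g fin rS ru in \<open>auto simp: ch_root\<close>)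
    then obtain h where h: "valid_choice S h"
      "(\<Sum>y\<in>S. w (y, h y)) \<le> (\<Sum>y\<in>S - {r}. w (y, g y)) + t" by blast
    have "sum w A \<le> sum w ((\<lambda>x. (x, h x)) ` S)"
      using A valid_choice_arb(1)[OF fin h(1)] unfolding is_MSA_def by blast
    moreover have "sum w A = (\<Sum>x\<in>S. w (x, f x))"
      unfolding f(2) by (rule valid_choice_arb(2)[OF fin f(1)])
    ultimately show False
      using valid_choice_arb(2)[OF fin h(1), of w] h(2) g(2) by linarith
  qed
  then show ?thesis using f rS by auto
qed

text \<open>\<open>MSA_eventually_out\<close> quantifies over all minimal arborescences and would be
  vacuous without one. Some vertex \<open>s\<close> lies outside the finite set \<open>S\<close>,
  and letting every vertex point towards \<open>s\<close> gives an arborescence; minimality is then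
  a finite choice.\<close>

lemma MSA_exists:
  assumes fin: "finite S" and S: "S \<subseteq> V" and inf: "infinite V"
  shows "\<exists>A. is_MSA adj w S A"
proof -
  obtain s where s: "s \<in> V" "s \<notin> S" using fin inf S by (metis finite_subset subsetI)
  obtain p where "rooted_tree V adj s p" using reroot s by blast
  then interpret s: rooted_tree V adj s p .
  have "valid_choice S p"
    unfolding valid_choice_def
  proof
    fix x assume x: "x \<in> S"
    then have xs: "x \<in> V" "x \<noteq> s" "p x \<in> V" using S s s.par_in by auto
    have "p (p x) \<noteq> x" if "p x \<in> S"
    proof -
      have "p x \<noteq> s" using that s by auto
      then have "s.depth x = Suc (Suc (s.depth (p (p x))))" using xs s.depth_par by simp
      then show ?thesis by auto
    qed
    then show "adj x (p x) \<and> (p x \<in> S \<longrightarrow> p (p x) \<noteq> x)" using xs s.adj_iff by auto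
  qed
  then have ex: "spanning_arb adj S ((\<lambda>x. (x, p x)) ` S)" using valid_choice_arb fin by blast
  have "Collect (spanning_arb adj S) \<subseteq> Pow (Sigma S (\<lambda>x. {y. adj x y}))"
    by (auto simp: spanning_arb_def)
  then have finarb: "finite (Collect (spanning_arb adj S))"
    using finite_nbrs S fin by (meson finite_Pow_iff finite_SigmaI finite_subset subsetD)
  obtain A where A: "spanning_arb adj S A" "sum w A = Min (sum w ` Collect (spanning_arb adj S))"
    using Min_in[of "sum w ` Collect (spanning_arb adj S)"] finarb ex by (metis (no_types, lifting) empty_iff finite_imageI imageE image_eqI mem_Collect_eq)
  have "sum w A \<le> sum w B" if "spanning_arb adj S B" for B
    using A finarb that by simp
  then show ?thesis using A unfolding is_MSA_def by blast
qed

text \<open>The failure of the other neighbours is visible at a common finite depth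
  \<open>N\<close>, and every exhaustion eventually contains the ball of radius \<open>N\<close>.
  The edge obtained depends on the weights only.\<close>

lemma eventually_out_root:
  assumes exh: "exhaustion V Vs" and ru: "adj r u" and esc: "escape_le_all adj w r u t"
    and nesc: "\<And>u'. adj r u' \<Longrightarrow> u' \<noteq> u \<Longrightarrow> \<not> escape_le_all adj w r u' t"
  shows "MSA_eventually_out adj w Vs r u"
proof -
  have "\<exists>N. \<forall>u'\<in>{u'. adj r u'}. u' \<noteq> u \<longrightarrow> \<not> escape_le adj w N r u' t"
  proof -
    have "\<forall>u'\<in>{u'. adj r u'}. \<exists>N. u' \<noteq> u \<longrightarrow> \<not> escape_le adj w N r u' t"
      using nesc unfolding escape_le_all_def by blast
    then obtain N where N: "\<And>u'. adj r u' \<Longrightarrow> u' \<noteq> u \<Longrightarrow> \<not> escape_le adj w (N u') r u' t"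
      by (metis mem_Collect_eq)
    have "N u' \<le> Max (N ` {u'. adj r u'})" if "adj r u'" for u'
      using that finite_nbrs[OF root_in] by auto
    then show ?thesis using N escape_le_antimono by (metis mem_Collect_eq)
  qed
  then obtain N where N: "\<And>u'. adj r u' \<Longrightarrow> u' \<noteq> u \<Longrightarrow> \<not> escape_le adj w N r u' t" by blast
  have "\<exists>i. \<forall>y\<in>{y \<in> V. depth y \<le> N}. y \<in> Vs i"
  proof -
    have "\<forall>y\<in>{y \<in> V. depth y \<le> N}. \<exists>i. y \<in> Vs i" using exh unfolding exhaustion_def by blast
    then obtain I where I: "\<And>y. y \<in> V \<Longrightarrow> depth y \<le> N \<Longrightarrow> y \<in> Vs (I y)"
      by (metis (mono_tags, lifting) mem_Collect_eq)
    have "I y \<le> Max (I ` {y \<in> V. depth y \<le> N})" if "y \<in> V" "depth y \<le> N" for y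
      using that finite_ball by auto
    then show ?thesis using I exh unfolding exhaustion_def incseq_def by blast
  qed
  then obtain i where i: "\<And>y. y \<in> V \<Longrightarrow> depth y \<le> N \<Longrightarrow> y \<in> Vs i" by blast
  show ?thesis
    unfolding MSA_eventually_out_def eventually_sequentially
  proof (intro exI[of _ i] allI impI)
    fix j A assume "i \<le> j" and A: "is_MSA adj w (Vs j) A"
    then have "Vs i \<subseteq> Vs j" "finite (Vs j)" using exh unfolding exhaustion_def incseq_def by auto
    then show "(r, u) \<in> A"
      using MSA_out_root[OF _ A ru esc N] i by blast
  qed
qed

lemma eventually_out_unique:
  assumes exh: "exhaustion V Vs" and inf: "infinite V" and v: "v \<in> V"
    and 1: "MSA_eventually_out adj w Vs v u" and 2: "MSA_eventually_out adj w Vs v u'"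
  shows "u = u'"
proof -
  obtain i0 where i0: "v \<in> Vs i0" using exh v unfolding exhaustion_def by blast
  have "eventually (\<lambda>i. i \<ge> i0) sequentially" by (rule eventually_ge_at_top)
  with 1 2 have "eventually (\<lambda>i. i \<ge> i0 \<and> (\<forall>A. is_MSA adj w (Vs i) A \<longrightarrow> (v, u) \<in> A)
      \<and> (\<forall>A. is_MSA adj w (Vs i) A \<longrightarrow> (v, u') \<in> A)) sequentially"
    unfolding MSA_eventually_out_def by eventually_elim auto
  then obtain i where i: "i \<ge> i0" "\<And>A. is_MSA adj w (Vs i) A \<Longrightarrow> (v, u) \<in> A"
    "\<And>A. is_MSA adj w (Vs i) A \<Longrightarrow> (v, u') \<in> A"
    using eventually_happens by fastforce
  have "v \<in> Vs i" using i0 i(1) exh unfolding exhaustion_def incseq_def by blast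
  moreover obtain A where A: "is_MSA adj w (Vs i) A"
    using MSA_exists inf exh unfolding exhaustion_def by meson
  moreover have "(v, u) \<in> A" "(v, u') \<in> A" using i A by auto
  ultimately show ?thesis unfolding is_MSA_def spanning_arb_def by blast
qed

end

section \<open>Exponential weights\<close>

abbreviation exp1 :: "real measure" where
  "exp1 \<equiv> density lborel (exponential_density 1)"

lemma exp1_eq: "ennreal (exponential_density 1 x) = ennreal (exp (- x)) * indicator {0..} x"
  by (auto simp: exponential_density_def indicator_def)

lemma prob_space_exp1: "prob_space exp1"
  by (rule prob_space_exponential_density) simp

lemma AE_exp1_nonneg: "AE x in exp1. 0 \<le> x"
  by (subst AE_density) (auto simp: exponential_density_def)

lemma AE_exp1_neq: "AE x in exp1. x \<noteq> c"
  by (subst AE_density) (use AE_lborel_singleton[of c] in auto)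

lemma nn_integral_exp1:
  assumes "f \<in> borel_measurable borel"
  shows "(\<integral>\<^sup>+x. f x \<partial>exp1) = (\<integral>\<^sup>+x. ennreal (exp (- x)) * f x * indicator {0..} x \<partial>lborel)"
  using assms by (subst nn_integral_density) (auto simp: exp1_eq mult_ac)

lemma nn_integral_exp1_power: "(\<integral>\<^sup>+x. ennreal (x ^ k) \<partial>exp1) = ennreal (fact k)"
proof -
  have "(\<integral>\<^sup>+x. ennreal (x ^ k) \<partial>exp1) = (\<integral>\<^sup>+x. ennreal (x ^ k * exp (- x)) * indicator {0..} x \<partial>lborel)"
    by (subst nn_integral_exp1)
      (auto intro!: nn_integral_cong simp: indicator_def ennreal_mult'' mult.commute)
  then show ?thesis using nn_intergal_power_times_exp_Ici[of k] by simp
qed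

lemma integral_exp1_power: "integrable exp1 (\<lambda>x. x ^ k)" "(\<integral>x. x ^ k \<partial>exp1) = fact k"
proof -
  have "has_bochner_integral exp1 (\<lambda>x. x ^ k) (fact k)"
    by (rule has_bochner_integral_nn_integral)
      (use AE_exp1_nonneg nn_integral_exp1_power in auto)
  then show "integrable exp1 (\<lambda>x. x ^ k)" "(\<integral>x. x ^ k \<partial>exp1) = fact k"
    by (auto simp: has_bochner_integral_iff)
qed

text \<open>\<open>F\<close> is an antiderivative that includes the density
  \<open>exp (- x)\<close>. The point \<open>x = W\<close>, where the strict condition differs from
  the closed interval, is a null set.\<close>

lemma nn_integral_exp1_FTC:
  assumes "0 \<le> (W::real)" and F: "\<And>x. (F has_real_derivative exp (- x) * f x) (at x)"
    and f: "\<And>x. x \<le> W \<Longrightarrow> 0 \<le> f x" "f \<in> borel_measurable borel"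
  shows "(\<integral>\<^sup>+x. ennreal (if x < W then f x else 0) \<partial>exp1) = ennreal (F W - F 0)"
proof -
  have "(\<integral>\<^sup>+x. ennreal (if x < W then f x else 0) \<partial>exp1) =
      (\<integral>\<^sup>+x. ennreal (exp (- x)) * ennreal (if x < W then f x else 0) * indicator {0..} x \<partial>lborel)"
    using f by (subst nn_integral_exp1) auto
  also have "\<dots> = (\<integral>\<^sup>+x. ennreal (exp (- x) * f x) * indicator {0..W} x \<partial>lborel)"
    by (rule nn_integral_cong_AE, use AE_lborel_singleton[of W] in eventually_elim)
      (auto simp: indicator_def ennreal_mult' f)
  also have "\<dots> = ennreal (F W - F 0)"
    using assms by (intro nn_integral_FTC_Icc) (auto intro: DERIV_subset has_field_derivative_at_within)
  finally show ?thesis .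
qed

text \<open>For exponential \<open>a\<close> and \<open>b\<close> the identity is harmonic for the walk with these steps,
  killed when the budget \<open>W\<close> does not suffice to pay \<open>a\<close>.\<close>
definition budget_step :: "real \<Rightarrow> real \<Rightarrow> real \<Rightarrow> real" where
  "budget_step W a b = (if a < W then W - a + b else 0)"

lemma budget_step_measurable [measurable]:
  assumes [measurable]: "f \<in> borel_measurable M" "g \<in> borel_measurable M" "h \<in> borel_measurable M"
  shows "(\<lambda>x. budget_step (f x) (g x) (h x)) \<in> borel_measurable M"
  unfolding budget_step_def by measurable

lemma integral_budget_step_snd: "(\<integral>b. budget_step W a b \<partial>exp1) = (if a < W then W - a + 1 else 0)"
proof -
  interpret prob_space exp1 by (rule prob_space_exp1)
  have "integrable exp1 (\<lambda>x. x)" "(\<integral>x. x \<partial>exp1) = 1" using integral_exp1_power[of 1] by auto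
  moreover have "measure exp1 UNIV = 1" using prob_space by simp
  ultimately show ?thesis by (simp add: budget_step_def)
qed

text \<open>The summand 1 is the mean of the payback. With it the integrand times the density is the
  exact derivative of \<open>- (W - x) * exp (- x)\<close>, which runs from \<open>- W\<close> to
  0.\<close>

lemma integral_budget_step_fst:
  assumes "0 \<le> W"
  shows "integrable exp1 (\<lambda>a. if a < W then W - a + 1 else 0)"
    and "(\<integral>a. (if a < W then W - a + 1 else 0) \<partial>exp1) = W"
proof -
  have "(\<integral>\<^sup>+x. ennreal (if x < W then W - x + 1 else 0) \<partial>exp1) =
      ennreal ((\<lambda>x. - (W - x) * exp (- x)) W - (\<lambda>x. - (W - x) * exp (- x)) 0)"
    by (rule nn_integral_exp1_FTC) (use assms in \<open>auto intro!: derivative_eq_intros simp: algebra_simps\<close>)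
  then have "has_bochner_integral exp1 (\<lambda>a. if a < W then W - a + 1 else 0) W"
    using assms by (intro has_bochner_integral_nn_integral) auto
  then show "integrable exp1 (\<lambda>a. if a < W then W - a + 1 else 0)"
    and "(\<integral>a. (if a < W then W - a + 1 else 0) \<partial>exp1) = W"
    by (auto simp: has_bochner_integral_iff)
qed

text \<open>The constant 2 is the sum of the variances of the two weights. The exact value is
  \<open>W\<^sup>2 + 2 - 2 * exp (- W)\<close>, and the last term is dropped at the end.\<close>

lemma nn_integral_budget_step_square:
  assumes "0 \<le> W"
  shows "(\<integral>\<^sup>+a. \<integral>\<^sup>+b. ennreal ((budget_step W a b)\<^sup>2) \<partial>exp1 \<partial>exp1) \<le> ennreal (W\<^sup>2 + 2)"
proof -
  interpret prob_space exp1 by (rule prob_space_exp1)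
  have 1: "(\<integral>\<^sup>+b. ennreal ((c + b)\<^sup>2) \<partial>exp1) = ennreal (c\<^sup>2 + 2 * c + 2)" for c :: real
  proof -
    have i: "integrable exp1 (\<lambda>x. x)" "(\<integral>x. x \<partial>exp1) = 1" "integrable exp1 (\<lambda>x. x\<^sup>2)" "(\<integral>x. x\<^sup>2 \<partial>exp1) = 2"
      using integral_exp1_power[of 1] integral_exp1_power[of 2] by (auto simp: fact_numeral)
    have sq: "(c + b)\<^sup>2 = c\<^sup>2 + 2 * c * b + b\<^sup>2" for b
      by (simp add: power2_eq_square algebra_simps)
    have "(\<integral>\<^sup>+b. ennreal ((c + b)\<^sup>2) \<partial>exp1) = ennreal (\<integral>b. (c + b)\<^sup>2 \<partial>exp1)"
    proof (rule nn_integral_eq_integral)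
      show "integrable exp1 (\<lambda>b. (c + b)\<^sup>2)"
        unfolding sq using i by (intro Bochner_Integration.integrable_add integrable_mult_right integrable_const)
    qed simp
    also have "(\<integral>b. (c + b)\<^sup>2 \<partial>exp1) = (\<integral>b. c\<^sup>2 + 2 * c * b + b\<^sup>2 \<partial>exp1)"
      by (simp only: sq)
    finally have "(\<integral>\<^sup>+b. ennreal ((c + b)\<^sup>2) \<partial>exp1) = ennreal (\<integral>b. c\<^sup>2 + 2 * c * b + b\<^sup>2 \<partial>exp1)" .
    moreover have "measure exp1 UNIV = 1" using prob_space by simp
    ultimately show ?thesis using i by simp
  qed
  have "(\<integral>\<^sup>+a. \<integral>\<^sup>+b. ennreal ((budget_step W a b)\<^sup>2) \<partial>exp1 \<partial>exp1) =
      (\<integral>\<^sup>+a. ennreal (if a < W then (W - a)\<^sup>2 + 2 * (W - a) + 2 else 0) \<partial>exp1)"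
    by (intro nn_integral_cong) (auto simp: budget_step_def 1)
  also have "\<dots> = ennreal ((\<lambda>x. - ((W - x)\<^sup>2 + 2) * exp (- x)) W - (\<lambda>x. - ((W - x)\<^sup>2 + 2) * exp (- x)) 0)"
  proof (rule nn_integral_exp1_FTC)
    show "0 \<le> (W - x)\<^sup>2 + 2 * (W - x) + 2" if "x \<le> W" for x
      using that by (intro add_nonneg_nonneg) auto
  qed (use assms in \<open>auto intro!: derivative_eq_intros simp: algebra_simps\<close>)
  also have "\<dots> \<le> ennreal (W\<^sup>2 + 2)" by (intro ennreal_leI) simp
  finally show ?thesis .
qed

section \<open>Resampling one coordinate\<close>

abbreviation edges :: "('v \<Rightarrow> 'v \<Rightarrow> bool) \<Rightarrow> ('v \<times> 'v) set" where
  "edges adj \<equiv> {(u, v). adj u v}"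

lemma prob_space_exp_weights: "prob_space (exp_weights adj)"
  unfolding exp_weights_def by (rule prob_space_PiM) (rule prob_space_exp1)

lemma sets_exp_weights: "sets (exp_weights adj) = sets (PiM (edges adj) (\<lambda>_. borel))"
  unfolding exp_weights_def by (intro sets_PiM_cong) auto

lemma weight_measurable: "e \<in> edges adj \<Longrightarrow> (\<lambda>w. w e) \<in> borel_measurable (exp_weights adj)"
  unfolding measurable_cong_sets[OF sets_exp_weights refl] by (rule measurable_component_singleton)

lemma resample_measurable:
  assumes "e \<in> edges adj"
  shows "(\<lambda>(a, w). w(e := a)) \<in> measurable (exp1 \<Otimes>\<^sub>M exp_weights adj) (exp_weights adj)"
proof -
  have "(\<lambda>(a, w). w(e := a)) = (\<lambda>p::real \<times> ('a \<times> 'a \<Rightarrow> real). (snd p)(e := fst p))"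
    by (auto simp: fun_eq_iff)
  moreover have "(\<lambda>p. (snd p)(e := fst p)) \<in> measurable (exp1 \<Otimes>\<^sub>M exp_weights adj) (exp_weights adj)"
    unfolding exp_weights_def using assms
    by (intro measurable_fun_upd[where J = "edges adj"]) auto
  ultimately show ?thesis by simp
qed

text \<open>Independence in the form used below: a fresh independent copy of one coordinate leaves
  the product law unchanged.\<close>

lemma resample_distr:
  assumes "e \<in> edges adj"
  shows "distr (exp1 \<Otimes>\<^sub>M exp_weights adj) (exp_weights adj) (\<lambda>(a, w). w(e := a)) = exp_weights adj"
  using distr_pair_PiM_eq_PiM[of "edges adj" "\<lambda>_. exp1" e] assms
  by (simp add: exp_weights_def insert_absorb prob_space_exp1)

lemma pair_prob_space_weights: "pair_prob_space exp1 (exp_weights adj)"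
  unfolding pair_prob_space_def pair_sigma_finite_def
  by (simp add: prob_space_exp1 prob_space_exp_weights prob_space_imp_sigma_finite)

lemma nn_integral_resample:
  assumes e: "e \<in> edges adj" and f: "f \<in> borel_measurable (exp_weights adj)"
  shows "(\<integral>\<^sup>+w. f w \<partial>exp_weights adj) = (\<integral>\<^sup>+w. \<integral>\<^sup>+a. f (w(e := a)) \<partial>exp1 \<partial>exp_weights adj)"
proof -
  interpret pair_prob_space exp1 "exp_weights adj" by (rule pair_prob_space_weights)
  note m = measurable_compose[OF resample_measurable[OF e] f, simplified case_prod_beta]
  have "(\<integral>\<^sup>+w. f w \<partial>exp_weights adj) =
      (\<integral>\<^sup>+p. f ((snd p)(e := fst p)) \<partial>(exp1 \<Otimes>\<^sub>M exp_weights adj))"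
    by (subst resample_distr[OF e, symmetric], subst nn_integral_distr)
      (use resample_measurable[OF e] f in \<open>auto simp: case_prod_beta\<close>)
  also have "\<dots> = (\<integral>\<^sup>+w. \<integral>\<^sup>+a. f (w(e := a)) \<partial>exp1 \<partial>exp_weights adj)"
    using nn_integral_snd[OF m] by (simp add: case_prod_beta)
  finally show ?thesis .
qed

lemma integral_resample:
  fixes f :: "('v \<times> 'v \<Rightarrow> real) \<Rightarrow> real"
  assumes e: "e \<in> edges adj" and f: "integrable (exp_weights adj) f"
  shows "integrable (exp_weights adj) (\<lambda>w. \<integral>a. f (w(e := a)) \<partial>exp1)"
    and "(\<integral>w. f w \<partial>exp_weights adj) = (\<integral>w. \<integral>a. f (w(e := a)) \<partial>exp1 \<partial>exp_weights adj)"
proof -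
  interpret pair_prob_space exp1 "exp_weights adj" by (rule pair_prob_space_weights)
  have fm: "f \<in> borel_measurable (exp_weights adj)" using f by auto
  have "integrable (distr (exp1 \<Otimes>\<^sub>M exp_weights adj) (exp_weights adj) (\<lambda>(a, w). w(e := a))) f"
    unfolding resample_distr[OF e] by fact
  then have "integrable (exp1 \<Otimes>\<^sub>M exp_weights adj) (\<lambda>p. f ((snd p)(e := fst p)))"
    using integrable_distr[OF resample_measurable[OF e]] by (simp add: case_prod_beta)
  then have i: "integrable (exp1 \<Otimes>\<^sub>M exp_weights adj) (\<lambda>(a, w). f (w(e := a)))"
    by (simp only: case_prod_beta')
  then show "integrable (exp_weights adj) (\<lambda>w. \<integral>a. f (w(e := a)) \<partial>exp1)"
    by (rule integrable_snd)
  have "(\<integral>w. f w \<partial>exp_weights adj) =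
      (\<integral>p. f ((snd p)(e := fst p)) \<partial>(exp1 \<Otimes>\<^sub>M exp_weights adj))"
    by (subst resample_distr[OF e, symmetric], subst integral_distr)
      (use resample_measurable[OF e] fm in \<open>auto simp: case_prod_beta\<close>)
  also have "\<dots> = (\<integral>w. \<integral>a. f (w(e := a)) \<partial>exp1 \<partial>exp_weights adj)"
    using integral_snd[OF i] by (simp add: case_prod_beta')
  finally show "(\<integral>w. f w \<partial>exp_weights adj) = (\<integral>w. \<integral>a. f (w(e := a)) \<partial>exp1 \<partial>exp_weights adj)" .
qed

lemma AE_weight_nonneg: "e \<in> edges adj \<Longrightarrow> AE w in exp_weights adj. 0 \<le> w e"
  unfolding exp_weights_def using prob_space_exp1 AE_exp1_nonneg by (intro AE_PiM_component) auto

text \<open>The threshold is a random variable because the recursion passes on a threshold that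
  depends on the weights.\<close>

lemma escape_le_measurable:
  assumes "\<And>x. finite {y. adj x y}" "adj v u" "adj u v" "\<And>x y. adj x y \<Longrightarrow> adj y x"
    "t \<in> borel_measurable (exp_weights adj)"
  shows "{w \<in> space (exp_weights adj). escape_le adj w n v u (t w)} \<in> sets (exp_weights adj)"
  using assms(2,3,5)
proof (induction n arbitrary: v u t)
  case 0
  have [measurable]: "(\<lambda>w. w (v, u)) \<in> borel_measurable (exp_weights adj)"
    using 0 by (intro weight_measurable) auto
  have [measurable]: "t \<in> borel_measurable (exp_weights adj)" by fact
  show ?case by simp
next
  case (Suc n)
  have [measurable]: "(\<lambda>w. w (v, u)) \<in> borel_measurable (exp_weights adj)"
    "(\<lambda>w. w (u, v)) \<in> borel_measurable (exp_weights adj)"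
    using Suc by (auto intro!: weight_measurable)
  have [measurable]: "t \<in> borel_measurable (exp_weights adj)" by fact
  have 1: "{w \<in> space (exp_weights adj). w (v, u) \<le> t w} \<in> sets (exp_weights adj)" by simp
  have 2: "{w \<in> space (exp_weights adj). escape_le adj w n u c (t w - w (v, u) + w (u, v))}
      \<in> sets (exp_weights adj)" if "adj u c" for c
    using that assms(4) by (intro Suc.IH) auto
  have "{w \<in> space (exp_weights adj). escape_le adj w (Suc n) v u (t w)} =
      {w \<in> space (exp_weights adj). w (v, u) \<le> t w} \<inter>
      (\<Union>c\<in>{c. adj u c} - {v}. {w \<in> space (exp_weights adj).
         escape_le adj w n u c (t w - w (v, u) + w (u, v))})"
    by auto
  also have "\<dots> \<in> sets (exp_weights adj)"
    using assms(1)[of u] 1 2 by (intro sets.Int sets.finite_UN) auto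
  finally show ?case .
qed

lemma nn_integral_resample2:
  assumes e: "e \<in> edges adj" "e' \<in> edges adj" and f: "f \<in> borel_measurable (exp_weights adj)"
  shows "(\<integral>\<^sup>+w. f w \<partial>exp_weights adj) =
    (\<integral>\<^sup>+w. \<integral>\<^sup>+a. \<integral>\<^sup>+b. f (w(e := a, e' := b)) \<partial>exp1 \<partial>exp1 \<partial>exp_weights adj)"
proof -
  interpret pair_prob_space exp1 "exp_weights adj" by (rule pair_prob_space_weights)
  have "(\<lambda>w. \<integral>\<^sup>+b. f (w(e' := b)) \<partial>exp1) \<in> borel_measurable (exp_weights adj)"
    using measurable_pair_swap[OF measurable_compose[OF resample_measurable[OF e(2)] f]]
    by (intro M1.borel_measurable_nn_integral) (simp add: case_prod_beta')
  then show ?thesis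
    using nn_integral_resample[OF e(2) f] nn_integral_resample[OF e(1)] by simp
qed

lemma integral_resample2:
  fixes f :: "('v \<times> 'v \<Rightarrow> real) \<Rightarrow> real"
  assumes e: "e \<in> edges adj" "e' \<in> edges adj" and f: "integrable (exp_weights adj) f"
  shows "(\<integral>w. f w \<partial>exp_weights adj) =
    (\<integral>w. \<integral>a. \<integral>b. f (w(e := a, e' := b)) \<partial>exp1 \<partial>exp1 \<partial>exp_weights adj)"
  using integral_resample(2)[OF e(2) f] integral_resample(2)[OF e(1) integral_resample(1)[OF e(2) f]]
  by simp

section \<open>Second moment bound for positivity\<close>

lemma integrable_mult_L2:
  fixes f g :: "'a \<Rightarrow> real"
  assumes [measurable]: "f \<in> borel_measurable M" "g \<in> borel_measurable M"
    and "integrable M (\<lambda>x. (f x)\<^sup>2)" "integrable M (\<lambda>x. (g x)\<^sup>2)"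
  shows "integrable M (\<lambda>x. f x * g x)"
proof (rule Bochner_Integration.integrable_bound)
  show "integrable M (\<lambda>x. (f x)\<^sup>2 + (g x)\<^sup>2)" using assms by auto
  have "\<bar>a * b\<bar> \<le> a\<^sup>2 + b\<^sup>2" for a b :: real
  proof -
    have "0 \<le> (\<bar>a\<bar> - \<bar>b\<bar>)\<^sup>2" by simp
    then have "2 * \<bar>a * b\<bar> \<le> a\<^sup>2 + b\<^sup>2" by (simp add: power2_eq_square abs_mult algebra_simps)
    then show ?thesis using abs_ge_zero[of "a * b"] by linarith
  qed
  then show "AE x in M. norm (f x * g x) \<le> norm ((f x)\<^sup>2 + (g x)\<^sup>2)" by auto
qed simp

text \<open>The Cauchy-Schwarz bound for the mean of \<open>X\<close> on the event that it is
  positive, derived from the pointwise inequality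
  \<open>2 * c * X \<le> X\<^sup>2 + c\<^sup>2\<close>. No sign condition on \<open>X\<close> is
  required.\<close>

lemma (in prob_space) prob_pos_second_moment:
  fixes X :: "'a \<Rightarrow> real"
  assumes X [measurable]: "X \<in> borel_measurable M" and sq: "integrable M (\<lambda>x. (X x)\<^sup>2)"
    and m: "expectation X = m" "0 < m" and s: "expectation (\<lambda>x. (X x)\<^sup>2) \<le> s" "0 < s"
  shows "m\<^sup>2 / s \<le> prob {x \<in> space M. 0 < X x}"
proof -
  let ?A = "{x \<in> space M. 0 < X x}"
  \<comment> \<open>A non-integrable function has Bochner integral 0, which \<open>0 < m\<close>
    excludes.\<close>
  have iX: "integrable M X" using m(1,2) not_integrable_integral_eq by fastforce
  \<comment> \<open>With this value the quadratic term contributes at most \<open>m / 2\<close>,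
    half of the mean, and the remaining half bounds the probability.\<close>
  define c where "c = s / m"
  have c: "0 < c" using m s by (simp add: c_def)
  have pt: "X x \<le> (X x)\<^sup>2 / (2 * c) + c / 2 * indicator ?A x" if "x \<in> space M" for x
  proof (cases "0 < X x")
    case True
    have "0 \<le> (X x - c)\<^sup>2" by simp
    then have "2 * c * X x \<le> (X x)\<^sup>2 + c\<^sup>2" by (simp add: power2_eq_square algebra_simps)
    then have "X x \<le> ((X x)\<^sup>2 + c\<^sup>2) / (2 * c)" using c by (simp add: field_simps)
    also have "\<dots> = (X x)\<^sup>2 / (2 * c) + c / 2"
      using c by (simp add: add_divide_distrib power2_eq_square)
    finally show ?thesis using True that by simp
  next
    case False
    then have "X x \<le> (X x)\<^sup>2 / (2 * c)" using c by (intro order_trans[of "X x" 0 "(X x)\<^sup>2 / (2 * c)"]) (simp_all add: not_less)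
    then show ?thesis using False by simp
  qed
  have iA: "integrable M (\<lambda>x. c / 2 * indicator ?A x)"
    by (intro integrable_mult_right integrable_real_indicator) (auto simp: emeasure_eq_measure)
  have "m \<le> expectation (\<lambda>x. (X x)\<^sup>2 / (2 * c) + c / 2 * indicator ?A x)"
    unfolding m(1)[symmetric] 
    by (intro integral_mono Bochner_Integration.integrable_add iX iA pt integrable_divide_zero)
      (use sq in auto)
  also have "\<dots> = expectation (\<lambda>x. (X x)\<^sup>2) / (2 * c) + c / 2 * prob ?A"
    using sq iA by (subst Bochner_Integration.integral_add) auto
  also have "\<dots> \<le> s / (2 * c) + c / 2 * prob ?A"
    using s c by (intro add_right_mono divide_right_mono) auto
  also have "s / (2 * c) = m / 2" using s m by (simp add: c_def)
  finally have "m \<le> c * prob ?A" by simp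
  then have "m * m \<le> s * prob ?A" using m by (simp add: c_def field_simps)
  then show ?thesis using s by (simp add: field_simps power2_eq_square)
qed

lemma integrable_budget_step: "integrable exp1 (\<lambda>b. budget_step W a b)"
proof -
  interpret prob_space exp1 by (rule prob_space_exp1)
  show ?thesis using integral_exp1_power(1)[of 1] by (cases "a < W") (simp_all add: budget_step_def)
qed

section \<open>The budget process along the rays\<close>

context rooted_tree
begin

text \<open>The level is an argument of its own so that the recursion is structural; the value is
  meaningful for \<open>x\<close> in \<open>level n\<close>.\<close>

fun budget :: "real \<Rightarrow> ('v \<times> 'v \<Rightarrow> real) \<Rightarrow> nat \<Rightarrow> 'v \<Rightarrow> real" where
  "budget K w 0 x = K"
| "budget K w (Suc n) x = budget_step (budget K w n (par x)) (w (par x, x)) (w (x, par x))"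

lemma level_SucD: "x \<in> level (Suc n) \<Longrightarrow> par x \<in> level n \<and> x \<noteq> r \<and> x \<in> V \<and> adj x (par x) \<and> adj (par x) x"
  using level_Suc chD ch_adj by auto

text \<open>A budget on level \<open>n\<close> reads only weights on the path from the root, whose
  edges have both ends at depth at most \<open>n\<close>.\<close>

lemma budget_upd:
  assumes "x \<in> level n" "n < depth (fst e) \<or> n < depth (snd e)"
  shows "budget K (w(e := c)) n x = budget K w n x"
  using assms
proof (induction n arbitrary: x)
  case (Suc n)
  have "par x \<in> level n" "x \<noteq> r" "x \<in> V" using level_SucD Suc.prems by auto
  moreover have "e \<noteq> (par x, x)" "e \<noteq> (x, par x)"
    using Suc.prems calculation by (auto simp: level_def)
  ultimately show ?case using Suc by auto
qed simp

lemma budget_measurable: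
  "x \<in> level n \<Longrightarrow> (\<lambda>w. budget K w n x) \<in> borel_measurable (exp_weights adj)"
proof (induction n arbitrary: x)
  case (Suc n)
  then show ?case using level_SucD[OF Suc.prems]
    by (auto intro!: budget_step_measurable weight_measurable)
qed simp

lemma budget_nonneg:
  "(\<And>e. e \<in> edges adj \<Longrightarrow> 0 \<le> w e) \<Longrightarrow> 0 \<le> K \<Longrightarrow> x \<in> level n \<Longrightarrow> 0 \<le> budget K w n x"
proof (induction n arbitrary: x)
  case (Suc n)
  then have "0 \<le> w (x, par x)" using level_SucD by auto
  then show ?case by (simp add: budget_step_def)
qed simp

lemma AE_weights_nonneg: "AE w in exp_weights adj. \<forall>e\<in>edges adj. 0 \<le> w e"
  by (subst AE_ball_countable) (use countable_edges AE_weight_nonneg in auto)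

text \<open>Along a surviving path the threshold passed on by \<open>escape_le\<close> is exactly
  the budget, so a certificate at \<open>x\<close> is extended upwards edge by edge. Nonnegative
  weights ensure that survival at \<open>x\<close> implies survival at its ancestors; a vertex
  differs from its grandparent by depth, so nothing backtracks.\<close>

lemma escape_if_budget_pos:
  assumes w: "\<And>e. e \<in> edges adj \<Longrightarrow> 0 \<le> w e"
    and "x \<in> level (Suc j)" "0 < budget K w (Suc j) x" "escape_le adj w n (par x) x (budget K w j (par x))"
  shows "\<exists>u. adj r u \<and> escape_le adj w (n + j) r u K"
  using assms(2-)
proof (induction j arbitrary: x n)
  case 0
  then have "par x = r" "adj r x" using level_SucD[OF 0(1)] level_0 by auto
  then show ?case using 0 by auto
next
  case (Suc j)
  let ?y = "par x"
  have x: "?y \<in> level (Suc j)" "adj ?y x" "x \<in> level (Suc (Suc j))" using level_SucD Suc.prems by auto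
  have y: "par ?y \<in> level j" "adj (par ?y) ?y" "adj ?y (par ?y)" using level_SucD[OF x(1)] by auto
  have yp: "0 < budget K w (Suc j) ?y"
    using Suc.prems(2) w[of "(?y, x)"] x by (auto simp: budget_step_def split: if_splits)
  then have alive: "w (par ?y, ?y) < budget K w j (par ?y)"
    by (auto simp: budget_step_def split: if_splits)
  then have "budget K w (Suc j) ?y = budget K w j (par ?y) - w (par ?y, ?y) + w (?y, par ?y)"
    by (simp add: budget_step_def)
  moreover have "depth x \<noteq> depth (par ?y)" using x(3) y(1) by (simp add: level_def)
  then have "x \<noteq> par ?y" by metis
  ultimately have "escape_le adj w (Suc n) (par ?y) ?y (budget K w j (par ?y))"
    using Suc.prems(3) alive x by (auto intro!: exI[of _ x])
  from Suc.IH[OF x(1) yp this] show ?case by simp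
qed

lemma escape_if_budget_pos':
  assumes w: "\<And>e. e \<in> edges adj \<Longrightarrow> 0 \<le> w e"
    and "x \<in> level (Suc n)" "0 < budget K w (Suc n) x"
  shows "\<exists>u. adj r u \<and> escape_le adj w n r u K"
proof -
  have "escape_le adj w 0 (par x) x (budget K w n (par x))"
    using assms(3) by (auto simp: budget_step_def split: if_splits)
  from escape_if_budget_pos[OF w assms(2,3) this] show ?thesis by simp
qed

abbreviation increment :: "real \<Rightarrow> ('v \<times> 'v \<Rightarrow> real) \<Rightarrow> nat \<Rightarrow> 'v \<Rightarrow> real" where
  "increment K w n x \<equiv> budget K w (Suc n) x - budget K w n (par x)"

lemma budget_resample:
  assumes x: "x \<in> level (Suc n)"
  shows "budget K (w((par x, x) := a, (x, par x) := b)) n (par x) = budget K w n (par x)"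
    and "budget K (w((par x, x) := a, (x, par x) := b)) (Suc n) x = budget_step (budget K w n (par x)) a b"
proof -
  have "par x \<in> level n" "x \<noteq> par x" "n < depth x"
    using level_SucD[OF x] x by (auto simp: level_def dest: adj_neq)
  then show "budget K (w((par x, x) := a, (x, par x) := b)) n (par x) = budget K w n (par x)"
    "budget K (w((par x, x) := a, (x, par x) := b)) (Suc n) x = budget_step (budget K w n (par x)) a b"
    by (auto simp: budget_upd)
qed

text \<open>Nonnegative integrals are used because square integrability on the next level is deduced
  from this very bound.\<close>

lemma nn_integral_budget_square_le:
  assumes x: "x \<in> level (Suc n)" and K: "0 \<le> K"
  shows "(\<integral>\<^sup>+w. ennreal ((budget K w (Suc n) x)\<^sup>2) \<partial>exp_weights adj) \<le>
    (\<integral>\<^sup>+w. ennreal ((budget K w n (par x))\<^sup>2 + 2) \<partial>exp_weights adj)"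
proof -
  have e: "(par x, x) \<in> edges adj" "(x, par x) \<in> edges adj" using level_SucD[OF x] by auto
  have [measurable]: "(\<lambda>w. budget K w (Suc n) x) \<in> borel_measurable (exp_weights adj)"
    by (rule budget_measurable[OF x])
  have "(\<integral>\<^sup>+w. ennreal ((budget K w (Suc n) x)\<^sup>2) \<partial>exp_weights adj) =
    (\<integral>\<^sup>+w. \<integral>\<^sup>+a. \<integral>\<^sup>+b. ennreal ((budget_step (budget K w n (par x)) a b)\<^sup>2) \<partial>exp1 \<partial>exp1 \<partial>exp_weights adj)"
    by (subst nn_integral_resample2[OF e]) (simp_all only: budget_resample[OF x], measurable)
  also have "\<dots> \<le> (\<integral>\<^sup>+w. ennreal ((budget K w n (par x))\<^sup>2 + 2) \<partial>exp_weights adj)"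
  proof (rule nn_integral_mono_AE, use AE_weights_nonneg in eventually_elim)
    fix w :: "'v \<times> 'v \<Rightarrow> real" assume "\<forall>e\<in>edges adj. 0 \<le> w e"
    then have "0 \<le> budget K w n (par x)"
      by (intro budget_nonneg K conjunct1[OF level_SucD[OF x]]) auto
    then show "(\<integral>\<^sup>+a. \<integral>\<^sup>+b. ennreal ((budget_step (budget K w n (par x)) a b)\<^sup>2) \<partial>exp1 \<partial>exp1) \<le>
        ennreal ((budget K w n (par x))\<^sup>2 + 2)"
      by (rule nn_integral_budget_step_square)
  qed
  finally show ?thesis .
qed

lemma budget_square_integrable:
  assumes K: "0 \<le> K"
  shows "x \<in> level n \<Longrightarrow> integrable (exp_weights adj) (\<lambda>w. (budget K w n x)\<^sup>2)"
proof (induction n arbitrary: x)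
  case 0
  interpret prob_space "exp_weights adj" by (rule prob_space_exp_weights)
  show ?case by simp
next
  case (Suc n)
  interpret prob_space "exp_weights adj" by (rule prob_space_exp_weights)
  have m: "(\<lambda>w. (budget K w (Suc n) x)\<^sup>2) \<in> borel_measurable (exp_weights adj)"
    using budget_measurable[OF Suc.prems] by (rule borel_measurable_power)
  have "integrable (exp_weights adj) (\<lambda>w. (budget K w n (par x))\<^sup>2 + 2)"
    using Suc.IH level_SucD[OF Suc.prems] by auto
  then have "(\<integral>\<^sup>+w. ennreal ((budget K w n (par x))\<^sup>2 + 2) \<partial>exp_weights adj) < \<infinity>"
    by (subst nn_integral_eq_integral) auto
  then have "(\<integral>\<^sup>+w. ennreal ((budget K w (Suc n) x)\<^sup>2) \<partial>exp_weights adj) < \<infinity>"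
    using nn_integral_budget_square_le[OF Suc.prems K] by (rule le_less_trans[rotated])
  then show ?case using m by (intro integrableI_nonneg) (auto simp del: budget.simps)
qed

lemma integral_budget_square_le:
  assumes x: "x \<in> level (Suc n)" and K: "0 \<le> K"
  shows "(\<integral>w. (budget K w (Suc n) x)\<^sup>2 \<partial>exp_weights adj) \<le>
    (\<integral>w. (budget K w n (par x))\<^sup>2 \<partial>exp_weights adj) + 2"
proof -
  interpret prob_space "exp_weights adj" by (rule prob_space_exp_weights)
  have i: "integrable (exp_weights adj) (\<lambda>w. (budget K w n (par x))\<^sup>2)"
    using budget_square_integrable[OF K] level_SucD[OF x] by blast
  have "ennreal (\<integral>w. (budget K w (Suc n) x)\<^sup>2 \<partial>exp_weights adj) \<le>
      ennreal (\<integral>w. (budget K w n (par x))\<^sup>2 + 2 \<partial>exp_weights adj)"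
    using nn_integral_budget_square_le[OF x K] budget_square_integrable[OF K x] i
    by (subst (asm) (1 2) nn_integral_eq_integral) (auto simp del: budget.simps)
  moreover have "0 \<le> (\<integral>w. (budget K w n (par x))\<^sup>2 + 2 \<partial>exp_weights adj)"
    by (intro integral_nonneg_AE) auto
  moreover have "(\<integral>w. (budget K w n (par x))\<^sup>2 + 2 \<partial>exp_weights adj) =
      (\<integral>w. (budget K w n (par x))\<^sup>2 \<partial>exp_weights adj) + 2"
    using i by (simp add: prob_space)
  ultimately show ?thesis using ennreal_le_iff by metis
qed

lemma increment_measurable:
  "x \<in> level (Suc n) \<Longrightarrow> (\<lambda>w. increment K w n x) \<in> borel_measurable (exp_weights adj)"
  using budget_measurable level_SucD by (intro borel_measurable_diff) blast+

lemma increment_square_integrable: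
  assumes x: "x \<in> level (Suc n)" and K: "0 \<le> K"
  shows "integrable (exp_weights adj) (\<lambda>w. (increment K w n x)\<^sup>2)"
proof -
  have y: "par x \<in> level n" using level_SucD[OF x] by auto
  have "integrable (exp_weights adj) (\<lambda>w. budget K w (Suc n) x * budget K w n (par x))"
    using integrable_mult_L2 budget_square_integrable[OF K] budget_measurable x y by blast
  then show ?thesis
    using budget_square_integrable[OF K x] budget_square_integrable[OF K y]
    by (simp add: power2_diff mult.assoc del: budget.simps)
qed

text \<open>Orthogonality of martingale increments: \<open>Z\<close> ignores the two weights on the
  edge above \<open>x\<close>, and integrating these out annihilates the increment. It is applied to
  the budget of the parent, to increments at other vertices of the level, and to weighted
  totals.\<close>

lemma integral_mult_increment:
  assumes x: "x \<in> level (Suc n)" and K: "0 \<le> K"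
    and Z: "Z \<in> borel_measurable (exp_weights adj)" "integrable (exp_weights adj) (\<lambda>w. (Z w)\<^sup>2)"
    and Zx: "\<And>w a b. Z (w((par x, x) := a, (x, par x) := b)) = Z w"
  shows "(\<integral>w. Z w * increment K w n x \<partial>exp_weights adj) = 0"
proof -
  interpret E: prob_space exp1 by (rule prob_space_exp1)
  have one: "measure exp1 UNIV = 1" using E.prob_space by simp
  have e: "(par x, x) \<in> edges adj" "(x, par x) \<in> edges adj" using level_SucD[OF x] by auto
  have i: "integrable (exp_weights adj) (\<lambda>w. Z w * increment K w n x)"
    using integrable_mult_L2[OF Z(1) increment_measurable[OF x] Z(2) increment_square_integrable[OF x K]] .
  have "(\<integral>w. Z w * increment K w n x \<partial>exp_weights adj) =
      (\<integral>w. \<integral>a. \<integral>b. Z w * (budget_step (budget K w n (par x)) a b - budget K w n (par x))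
         \<partial>exp1 \<partial>exp1 \<partial>exp_weights adj)"
    by (subst integral_resample2[OF e i]) (simp only: budget_resample[OF x] Zx)
  also have "\<dots> = 0"
  proof (rule integral_eq_zero_AE, use AE_weights_nonneg in eventually_elim)
    case (elim w)
    let ?W = "budget K w n (par x)"
    have W: "0 \<le> ?W" using elim by (intro budget_nonneg K conjunct1[OF level_SucD[OF x]]) auto
    have "(\<integral>b. Z w * (budget_step ?W a b - ?W) \<partial>exp1) = Z w * ((if a < ?W then ?W - a + 1 else 0) - ?W)" for a
      using integrable_budget_step[of ?W a] integral_budget_step_snd[of ?W a] by (simp add: one)
    then have "(\<integral>a. \<integral>b. Z w * (budget_step ?W a b - ?W) \<partial>exp1 \<partial>exp1) =
        (\<integral>a. Z w * ((if a < ?W then ?W - a + 1 else 0) - ?W) \<partial>exp1)"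
      by (simp only:)
    also have "\<dots> = 0"
      using integral_budget_step_fst[OF W] by (simp add: one)
    finally show ?case .
  qed
  finally show ?thesis .
qed

text \<open>By orthogonality the second moment of the budget grows by exactly the second moment of
  the increment, and that growth is at most 2.\<close>

lemma integral_increment_square_le:
  assumes x: "x \<in> level (Suc n)" and K: "0 \<le> K"
  shows "(\<integral>w. (increment K w n x)\<^sup>2 \<partial>exp_weights adj) \<le> 2"
proof -
  have y: "par x \<in> level n" using level_SucD[OF x] by auto
  let ?W = "\<lambda>w. budget K w n (par x)" and ?P = "exp_weights adj"
  have iW: "integrable ?P (\<lambda>w. (?W w)\<^sup>2)" using budget_square_integrable[OF K y] .
  have iWD: "integrable ?P (\<lambda>w. ?W w * increment K w n x)"
    using integrable_mult_L2[OF budget_measurable[OF y] increment_measurable[OF x] iW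
        increment_square_integrable[OF x K]] .
  have WD: "(\<integral>w. ?W w * increment K w n x \<partial>?P) = 0"
    by (rule integral_mult_increment[where Z = ?W, OF x K budget_measurable[OF y] iW budget_resample(1)[OF x]])
  have eq: "(budget K w (Suc n) x)\<^sup>2 = (?W w)\<^sup>2 + 2 * (?W w * increment K w n x) + (increment K w n x)\<^sup>2" for w
    by (simp add: power2_eq_square algebra_simps del: budget.simps)
  have "(\<integral>w. (budget K w (Suc n) x)\<^sup>2 \<partial>?P) =
      (\<integral>w. (?W w)\<^sup>2 \<partial>?P) + 2 * (\<integral>w. ?W w * increment K w n x \<partial>?P) + (\<integral>w. (increment K w n x)\<^sup>2 \<partial>?P)"
    unfolding eq using iW iWD increment_square_integrable[OF x K] by (simp del: budget.simps)
  then show ?thesis using integral_budget_square_le[OF x K] WD by simp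
qed

end

section \<open>Flows of finite energy and escape\<close>

text \<open>\<open>\<theta> x\<close> is the flow through the edge from \<open>par x\<close> to
  \<open>x\<close>, and \<open>\<theta> r\<close> is the strength of the source. At a leaf the
  conservation law says that no flow arrives.\<close>

locale flow_tree = rooted_tree +
  fixes \<theta> :: "'a \<Rightarrow> real" and energy :: real
  assumes flow_root: "\<theta> r = 1"
    and flow: "x \<in> V \<Longrightarrow> (\<Sum>c\<in>ch x. \<theta> c) = \<theta> x"
    and flow_nonneg: "x \<in> V \<Longrightarrow> 0 \<le> \<theta> x"
    and flow_energy: "finite F \<Longrightarrow> F \<subseteq> V - {r} \<Longrightarrow> (\<Sum>x\<in>F. (\<theta> x)\<^sup>2) \<le> energy"
begin

definition total_budget :: "real \<Rightarrow> nat \<Rightarrow> ('a \<times> 'a \<Rightarrow> real) \<Rightarrow> real" where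
  "total_budget K n w = (\<Sum>x\<in>level n. \<theta> x * budget K w n x)"

definition total_increment :: "real \<Rightarrow> nat \<Rightarrow> ('a \<times> 'a \<Rightarrow> real) \<Rightarrow> real" where
  "total_increment K n w = (\<Sum>x\<in>level (Suc n). \<theta> x * increment K w n x)"

text \<open>Conservation lets the weight of each vertex be split among its children, so the old
  total can be written over the next level.\<close>

lemma total_budget_Suc: "total_budget K (Suc n) w = total_budget K n w + total_increment K n w"
proof -
  have "total_budget K n w = (\<Sum>x\<in>level n. \<Sum>c\<in>ch x. \<theta> c * budget K w n (par c))"
    unfolding total_budget_def
  proof (rule sum.cong)
    fix x assume "x \<in> level n"
    then have x: "x \<in> V" by (simp add: level_def)
    have "(\<Sum>c\<in>ch x. \<theta> c * budget K w n (par c)) = (\<Sum>c\<in>ch x. \<theta> c * budget K w n x)"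
      by (intro sum.cong) (auto dest: chD)
    then show "\<theta> x * budget K w n x = (\<Sum>c\<in>ch x. \<theta> c * budget K w n (par c))"
      using flow[OF x] by (simp add: sum_distrib_right[symmetric])
  qed simp
  also have "\<dots> = (\<Sum>x\<in>level (Suc n). \<theta> x * budget K w n (par x))"
    by (simp only: sum_level_Suc)
  finally show ?thesis
    unfolding total_budget_def[of K "Suc n"] total_increment_def
    by (simp add: right_diff_distrib sum_subtractf del: budget.simps)
qed

lemma total_budget_measurable: "total_budget K n \<in> borel_measurable (exp_weights adj)"
  unfolding total_budget_def
  by (intro borel_measurable_sum borel_measurable_times budget_measurable) auto

lemma total_budget_resample:
  assumes x: "x \<in> level (Suc n)"
  shows "total_budget K n (w((par x, x) := a, (x, par x) := b)) = total_budget K n w"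
proof -
  have "n < depth x" using x by (simp add: level_def)
  then have "budget K (w((par x, x) := a, (x, par x) := b)) n y = budget K w n y" if "y \<in> level n" for y
    using that by (simp add: budget_upd)
  then show ?thesis unfolding total_budget_def by simp
qed

lemma increment_resample:
  assumes x: "x \<in> level (Suc n)" and y: "y \<in> level (Suc n)" "y \<noteq> x"
  shows "increment K (w((par x, x) := a, (x, par x) := b)) n y = increment K w n y"
proof -
  have "n < depth x" using x by (simp add: level_def)
  then have "budget K (w((par x, x) := a, (x, par x) := b)) n (par y) = budget K w n (par y)"
    using level_SucD[OF y(1)] by (simp add: budget_upd)
  moreover have "y \<noteq> par x" "x \<noteq> par y"
    using level_SucD[OF x] level_SucD[OF y(1)] x y by (auto simp: level_def)
  ultimately show ?thesis using y(2) by simp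
qed

text \<open>Expanding the square leaves only the diagonal: for \<open>y \<noteq> x\<close> the
  increment at \<open>y\<close> does not read the weights on the edge above
  \<open>x\<close>.\<close>

lemma total_increment_square:
  assumes K: "0 \<le> K"
  shows "integrable (exp_weights adj) (\<lambda>w. (total_increment K n w)\<^sup>2)"
    and "(\<integral>w. (total_increment K n w)\<^sup>2 \<partial>exp_weights adj) \<le> 2 * (\<Sum>x\<in>level (Suc n). (\<theta> x)\<^sup>2)"
proof -
  let ?P = "exp_weights adj" and ?L = "level (Suc n)"
  let ?D = "\<lambda>x w. increment K w n x"
  have eq: "(total_increment K n w)\<^sup>2 = (\<Sum>x\<in>?L. \<Sum>y\<in>?L. (\<theta> x * \<theta> y) * (?D y w * ?D x w))" for w
    unfolding total_increment_def power2_eq_square sum_product by (intro sum.cong) (simp_all only: mult_ac)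
  have i: "integrable ?P (\<lambda>w. ?D y w * ?D x w)" if "x \<in> ?L" "y \<in> ?L" for x y
    using that by (intro integrable_mult_L2 increment_measurable increment_square_integrable K)
  show "integrable ?P (\<lambda>w. (total_increment K n w)\<^sup>2)"
    unfolding eq by (intro Bochner_Integration.integrable_sum integrable_mult_right i)
  have "(\<integral>w. (total_increment K n w)\<^sup>2 \<partial>?P) = (\<Sum>x\<in>?L. \<Sum>y\<in>?L. \<theta> x * \<theta> y * (\<integral>w. ?D y w * ?D x w \<partial>?P))"
    unfolding eq
    by (subst Bochner_Integration.integral_sum,
        intro Bochner_Integration.integrable_sum integrable_mult_right i, assumption, assumption)
      (intro sum.cong refl, subst Bochner_Integration.integral_sum,
        (intro integrable_mult_right i; assumption), intro sum.cong refl integral_mult_right_zero)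
  also have "\<dots> \<le> (\<Sum>x\<in>?L. \<Sum>y\<in>?L. if y = x then 2 * (\<theta> x)\<^sup>2 else 0)"
  proof (intro sum_mono)
    fix x y assume x: "x \<in> ?L" and y: "y \<in> ?L"
    show "\<theta> x * \<theta> y * (\<integral>w. ?D y w * ?D x w \<partial>?P) \<le> (if y = x then 2 * (\<theta> x)\<^sup>2 else 0)"
    proof (cases "y = x")
      case True
      have "(\<theta> x)\<^sup>2 * (\<integral>w. (?D x w)\<^sup>2 \<partial>?P) \<le> (\<theta> x)\<^sup>2 * 2"
        by (intro mult_left_mono integral_increment_square_le x K) simp
      then show ?thesis using True by (simp add: power2_eq_square del: budget.simps)
    next
      case False
      have "(\<integral>w. ?D y w * ?D x w \<partial>?P) = 0"
        by (rule integral_mult_increment[where Z = "?D y", OF x K increment_measurable[OF y]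
            increment_square_integrable[OF y K] increment_resample[OF x y False]])
      then show ?thesis using False by simp
    qed
  qed
  also have "\<dots> = 2 * (\<Sum>x\<in>?L. (\<theta> x)\<^sup>2)"
    by (simp add: sum.delta finite_level sum_distrib_left)
  finally show "(\<integral>w. (total_increment K n w)\<^sup>2 \<partial>?P) \<le> 2 * (\<Sum>x\<in>?L. (\<theta> x)\<^sup>2)" .
qed

lemma total_increment_measurable: "total_increment K n \<in> borel_measurable (exp_weights adj)"
  unfolding total_increment_def
  by (intro borel_measurable_sum borel_measurable_times increment_measurable) auto

lemma integral_mult_total_increment:
  assumes K: "0 \<le> K"
    and Z: "Z \<in> borel_measurable (exp_weights adj)" "integrable (exp_weights adj) (\<lambda>w. (Z w)\<^sup>2)"
    and Zx: "\<And>x w a b. x \<in> level (Suc n) \<Longrightarrow> Z (w((par x, x) := a, (x, par x) := b)) = Z w"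
  shows "(\<integral>w. Z w * total_increment K n w \<partial>exp_weights adj) = 0"
proof -
  let ?P = "exp_weights adj" and ?L = "level (Suc n)"
  have eq: "Z w * total_increment K n w = (\<Sum>x\<in>?L. \<theta> x * (Z w * increment K w n x))" for w
    unfolding total_increment_def sum_distrib_left by (intro sum.cong) (simp_all only: mult_ac)
  have i: "integrable ?P (\<lambda>w. Z w * increment K w n x)" if "x \<in> ?L" for x
    using that by (intro integrable_mult_L2 Z increment_measurable increment_square_integrable K)
  have "(\<integral>w. Z w * total_increment K n w \<partial>?P) = (\<Sum>x\<in>?L. \<theta> x * (\<integral>w. Z w * increment K w n x \<partial>?P))"
    unfolding eq
    by (subst Bochner_Integration.integral_sum, (intro integrable_mult_right i; assumption))
      (intro sum.cong refl integral_mult_right_zero)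
  also have "\<dots> = 0"
  proof (intro sum.neutral ballI)
    fix x assume x: "x \<in> ?L"
    have "(\<integral>w. Z w * increment K w n x \<partial>?P) = 0"
      by (rule integral_mult_increment[where Z = Z, OF x K Z Zx[OF x]])
    then show "\<theta> x * (\<integral>w. Z w * increment K w n x \<partial>?P) = 0" by simp
  qed
  finally show ?thesis .
qed

text \<open>The claims are proved together because the vanishing of the cross term on the next level
  uses square integrability on this one.\<close>

lemma total_budget_moments:
  assumes K: "0 \<le> K"
  shows "integrable (exp_weights adj) (\<lambda>w. (total_budget K n w)\<^sup>2) \<and>
    (\<integral>w. total_budget K n w \<partial>exp_weights adj) = K \<and>
    (\<integral>w. (total_budget K n w)\<^sup>2 \<partial>exp_weights adj) \<le> K\<^sup>2 + 2 * (\<Sum>k<n. \<Sum>x\<in>level (Suc k). (\<theta> x)\<^sup>2)"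
proof (induction n)
  case 0
  interpret prob_space "exp_weights adj" by (rule prob_space_exp_weights)
  show ?case by (simp add: total_budget_def level_0 flow_root prob_space)
next
  case (Suc n)
  interpret prob_space "exp_weights adj" by (rule prob_space_exp_weights)
  let ?P = "exp_weights adj" and ?M = "total_budget K n" and ?S = "total_increment K n"
  have iM2: "integrable ?P (\<lambda>w. (?M w)\<^sup>2)" using Suc by blast
  note iS2 = total_increment_square(1)[OF K, of n]
  note mM = total_budget_measurable[of K n] and mS = total_increment_measurable[of K n]
  have iMS: "integrable ?P (\<lambda>w. ?M w * ?S w)" by (rule integrable_mult_L2[OF mM mS iM2 iS2])
  have iM: "integrable ?P ?M" using integrable_mult_L2[OF mM _ iM2, of "\<lambda>_. 1"] by simp
  have iS: "integrable ?P ?S" using integrable_mult_L2[OF mS _ iS2, of "\<lambda>_. 1"] by simp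
  have MS: "(\<integral>w. ?M w * ?S w \<partial>?P) = 0"
    by (rule integral_mult_total_increment[where Z = ?M, OF K mM iM2 total_budget_resample])
  have S: "(\<integral>w. ?S w \<partial>?P) = 0"
    using integral_mult_total_increment[OF K, of "\<lambda>_. 1"] by simp
  have sq: "(total_budget K (Suc n) w)\<^sup>2 = (?M w)\<^sup>2 + 2 * (?M w * ?S w) + (?S w)\<^sup>2" for w
    unfolding total_budget_Suc by (simp add: power2_eq_square algebra_simps)
  have "integrable ?P (\<lambda>w. (total_budget K (Suc n) w)\<^sup>2)"
    unfolding sq using iM2 iMS iS2 by simp
  moreover have "(\<integral>w. total_budget K (Suc n) w \<partial>?P) = K"
    unfolding total_budget_Suc using iM iS S Suc by simp
  moreover have "(\<integral>w. (total_budget K (Suc n) w)\<^sup>2 \<partial>?P) = (\<integral>w. (?M w)\<^sup>2 \<partial>?P) + (\<integral>w. (?S w)\<^sup>2 \<partial>?P)"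
    unfolding sq using iM2 iMS iS2 MS by simp
  ultimately show ?case
    using Suc total_increment_square(2)[OF K, of n] by (simp add: distrib_left)
qed

lemma prob_total_budget_pos:
  assumes K: "0 < K"
  shows "K\<^sup>2 / (K\<^sup>2 + 2 * energy) \<le> measure (exp_weights adj) {w \<in> space (exp_weights adj). 0 < total_budget K n w}"
proof -
  interpret prob_space "exp_weights adj" by (rule prob_space_exp_weights)
  have "0 \<le> energy" using flow_energy[of "{}"] by simp
  then have s: "0 < K\<^sup>2 + 2 * energy" using K by (simp add: add_pos_nonneg)
  have "(\<Sum>k<n. \<Sum>x\<in>level (Suc k). (\<theta> x)\<^sup>2) = (\<Sum>x\<in>(\<Union>k<n. level (Suc k)). (\<theta> x)\<^sup>2)"
    by (rule sum.UNION_disjoint[symmetric]) (simp_all add: finite_level, auto simp: level_def)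
  also have "\<dots> \<le> energy"
    by (rule flow_energy) (auto simp: finite_level dest: level_SucD)
  finally have "(\<integral>w. (total_budget K n w)\<^sup>2 \<partial>exp_weights adj) \<le> K\<^sup>2 + 2 * energy"
    using total_budget_moments[of K n] K by linarith
  then show ?thesis
    using total_budget_moments[of K n] K s
    by (intro prob_pos_second_moment total_budget_measurable) auto
qed

lemma escape_le_root_measurable:
  assumes "adj r u"
  shows "{w \<in> space (exp_weights adj). escape_le adj w n r u K} \<in> sets (exp_weights adj)"
proof (rule escape_le_measurable)
  show "finite {y. adj x y}" for x by (rule finite_nbrs')
qed (use assms adj_sym in auto)

definition escape_event :: "real \<Rightarrow> nat \<Rightarrow> ('a \<times> 'a \<Rightarrow> real) set" where
  "escape_event K n = {w \<in> space (exp_weights adj). \<exists>u. adj r u \<and> escape_le adj w n r u K}"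

lemma escape_event_sets: "escape_event K n \<in> sets (exp_weights adj)"
proof -
  have "escape_event K n = (\<Union>u\<in>{u. adj r u}. {w \<in> space (exp_weights adj). escape_le adj w n r u K})"
    by (auto simp: escape_event_def)
  then show ?thesis
    using finite_nbrs[OF root_in] escape_le_root_measurable by auto
qed

text \<open>With a nonnegative flow a positive average forces a positive budget at some vertex of
  the level. The bound does not depend on \<open>n\<close>, which permits passing to the
  intersection over all depths.\<close>

lemma prob_escape_event:
  assumes K: "0 < K"
  shows "K\<^sup>2 / (K\<^sup>2 + 2 * energy) \<le> measure (exp_weights adj) (escape_event K n)"
proof -
  interpret prob_space "exp_weights adj" by (rule prob_space_exp_weights)
  let ?A = "{w \<in> space (exp_weights adj). 0 < total_budget K (Suc n) w}"
  have "K\<^sup>2 / (K\<^sup>2 + 2 * energy) \<le> prob ?A" by (rule prob_total_budget_pos[OF K])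
  also have "\<dots> \<le> prob (escape_event K n)"
  proof (rule finite_measure_mono_AE)
    show "AE w in exp_weights adj. w \<in> ?A \<longrightarrow> w \<in> escape_event K n"
      using AE_weights_nonneg
    proof eventually_elim
      case (elim w)
      show ?case
      proof
        assume w: "w \<in> ?A"
        then have "\<not> (\<Sum>x\<in>level (Suc n). \<theta> x * budget K w (Suc n) x) \<le> 0"
          by (simp add: total_budget_def del: budget.simps)
        then obtain x where x: "x \<in> level (Suc n)" "0 < \<theta> x * budget K w (Suc n) x"
          by (meson sum_nonpos not_le)
        then have "0 < budget K w (Suc n) x"
          using flow_nonneg[of x] level_SucD by (metis mult_nonneg_nonpos not_le)
        then show "w \<in> escape_event K n"
          using escape_if_budget_pos'[of w x n K] elim x w by (auto simp: escape_event_def)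
      qed
    qed
  qed (rule escape_event_sets)
  finally show ?thesis .
qed

lemma AE_can_escape_root: "AE w in exp_weights adj. can_escape adj w r"
proof -
  interpret prob_space "exp_weights adj" by (rule prob_space_exp_weights)
  let ?P = "exp_weights adj"
  define B where "B K = (\<Inter>n. escape_event K n)" for K
  have Bs: "B K \<in> sets ?P" for K unfolding B_def using escape_event_sets by auto
  have dec: "decseq (escape_event K)" for K
    unfolding decseq_def escape_event_def by (auto intro: escape_le_antimono)
  have Bp: "K\<^sup>2 / (K\<^sup>2 + 2 * energy) \<le> prob (B K)" if "0 < K" for K
    unfolding B_def
    by (rule LIMSEQ_le_const[OF finite_Lim_measure_decseq])
      (use prob_escape_event[OF that] escape_event_sets dec in auto)
  \<comment> \<open>The first step may vary with the depth; since the root has finitely many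
    neighbours, one of them serves all depths.\<close>
  have Bc: "can_escape adj w r" if "w \<in> B K" for w K
  proof (rule ccontr)
    assume "\<not> can_escape adj w r"
    then have "\<forall>u\<in>{u. adj r u}. \<exists>n. \<not> escape_le adj w n r u K"
      by (auto simp: can_escape_def escape_le_all_def)
    from bchoice[OF this] obtain N where N: "\<And>u. adj r u \<Longrightarrow> \<not> escape_le adj w (N u) r u K" by blast
    let ?m = "Max (N ` {u. adj r u})"
    have "w \<in> escape_event K ?m" using that by (auto simp: B_def)
    then obtain u where u: "adj r u" "escape_le adj w ?m r u K" by (auto simp: escape_event_def)
    then have "N u \<le> ?m" using finite_nbrs[OF root_in] by auto
    then show False using N u escape_le_antimono by metis
  qed
  let ?C = "\<Union>k. B (real (Suc k))"
  have "(\<lambda>k. 1 - 2 * energy / real (Suc k)) \<longlonglongrightarrow> 1 - 0"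
    by (intro tendsto_diff tendsto_const LIMSEQ_Suc lim_const_over_n)
  moreover have "1 - 2 * energy / real (Suc k) \<le> prob ?C" for k
  proof -
    let ?K = "real (Suc k)"
    have E: "0 \<le> energy" using flow_energy[of "{}"] by simp
    have pos: "0 < ?K\<^sup>2 + 2 * energy" using E by (simp add: add_pos_nonneg)
    have "?K \<le> ?K\<^sup>2" by (rule self_le_power) simp_all
    then have "2 * energy / (?K\<^sup>2 + 2 * energy) \<le> 2 * energy / ?K"
      using E by (intro divide_left_mono) (auto intro: mult_pos_pos pos)
    moreover have "?K\<^sup>2 / (?K\<^sup>2 + 2 * energy) = 1 - 2 * energy / (?K\<^sup>2 + 2 * energy)"
      using pos by (simp add: field_simps)
    moreover have "prob (B ?K) \<le> prob ?C"
      using Bs by (intro finite_measure_mono sets.countable_UN) auto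
    ultimately show ?thesis using Bp[of ?K] by simp
  qed
  ultimately have "1 - 0 \<le> prob ?C" by (intro LIMSEQ_le_const2) blast+
  then have "prob ?C = 1" using prob_le_1[of ?C] by linarith
  then have "AE w in ?P. w \<in> ?C" using Bs by (intro AE_prob_1) auto
  then show ?thesis by eventually_elim (use Bc in blast)
qed

end

section \<open>Absence of ties\<close>

context rooted_tree
begin

text \<open>An escape heading away from the root never turns back, hence never reads the edge
  \<open>(r, u)\<close>.\<close>

lemma escape_le_upd:
  assumes "adj x y" "x \<noteq> r" "y \<noteq> r" "y \<noteq> par x"
  shows "escape_le adj (w((r, u) := a)) n x y t \<longleftrightarrow> escape_le adj w n x y t"
  using assms
proof (induction n arbitrary: x y t)
  case (Suc n)
  have y: "par y = x" using chD[OF adj_ch[OF Suc.prems(1)]] Suc.prems by auto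
  have "escape_le adj (w((r, u) := a)) n y c s \<longleftrightarrow> escape_le adj w n y c s" if "adj y c" "c \<noteq> x" for c s
  proof (rule Suc.IH)
    have "c \<in> ch y" using adj_ch[OF that(1)] that y by auto
    then show "c \<noteq> r" using chD by auto
  qed (use that y Suc.prems in auto)
  then show ?case using Suc.prems by (auto simp: fun_upd_other simp del: fun_upd_apply)
qed auto

lemma escape_le_root_upd_other:
  assumes "adj r u" "adj r u'" "u' \<noteq> u"
  shows "escape_le adj (w((r, u) := a)) n r u' t \<longleftrightarrow> escape_le adj w n r u' t"
proof (cases n)
  case (Suc m)
  have u': "par u' = r" "u' \<noteq> r" using assms ch_root chD by auto
  have "escape_le adj (w((r, u) := a)) m u' c s \<longleftrightarrow> escape_le adj w m u' c s" if "adj u' c" "c \<noteq> r" for c s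
    using that u' by (intro escape_le_upd) auto
  then show ?thesis using Suc assms u' by (auto simp: fun_upd_other simp del: fun_upd_apply)
qed (use assms in auto)

text \<open>The weight \<open>w (r, u)\<close> enters only through the difference between the
  threshold and this weight.\<close>

lemma escape_le_root_upd_shift:
  assumes "adj r u"
  shows "escape_le adj (w((r, u) := a)) n r u (t + a) \<longleftrightarrow> escape_le adj (w((r, u) := b)) n r u (t + b)"
proof (cases n)
  case (Suc m)
  have u: "par u = r" "u \<noteq> r" using assms ch_root chD by auto
  have eq: "escape_le adj (w((r, u) := x)) m u c s \<longleftrightarrow> escape_le adj w m u c s"
    if "adj u c" "c \<noteq> r" for c s x
    using that u by (intro escape_le_upd) auto
  have "escape_le adj (w((r, u) := x)) n r u (t + x) \<longleftrightarrow>
      0 \<le> t \<and> (\<exists>c. adj u c \<and> c \<noteq> r \<and> escape_le adj w m u c (t + w (u, r)))" for x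
    using u eq unfolding Suc escape_le.simps(2)
    by (auto simp: fun_upd_other fun_upd_same simp del: fun_upd_apply)
  then show ?thesis by blast
qed auto

text \<open>Equality of two possibly infinite costs, expressed through rational bounds to obtain a
  countable combination of measurable events. The last conjunct excludes the case that both are
  infinite.\<close>

definition tie_event :: "'v \<Rightarrow> 'v \<Rightarrow> ('v \<times> 'v \<Rightarrow> real) set" where
  "tie_event u u' = {w \<in> space (exp_weights adj).
     (\<forall>q\<in>\<rat>. escape_le_all adj w r u q \<longleftrightarrow> escape_le_all adj w r u' q) \<and>
     (\<exists>q\<in>\<rat>. escape_le_all adj w r u q)}"

lemma tie_event_sets:
  assumes "adj r u" "adj r u'"
  shows "tie_event u u' \<in> sets (exp_weights adj)"
proof -
  have m: "{w \<in> space (exp_weights adj). escape_le_all adj w r v q} \<in> sets (exp_weights adj)"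
    if "adj r v" for v q
    unfolding escape_le_all_def
    using escape_le_measurable[OF finite_nbrs' that adj_sym[OF that] adj_sym, of "\<lambda>_. q"]
    by (intro sets.sets_Collect_countable_All) auto
  note [measurable] = m[OF assms(1)] m[OF assms(2)]
  show ?thesis
    unfolding tie_event_def using countable_rat
    by (intro sets.sets_Collect_conj sets.sets_Collect_countable_Ball sets.sets_Collect_countable_Bex
        sets.sets_Collect_imp sets.sets_Collect_const) measurable
qed

text \<open>Increasing \<open>w (r, u)\<close> translates the set of admissible bounds for \<open>u\<close> and leaves
  that for \<open>u'\<close> unchanged, so at most one value of \<open>w (r, u)\<close> makes the two sets agree.\<close>
lemma tie_event_section:
  assumes uu: "adj r u" "adj r u'" "u' \<noteq> u"
    and 1: "w((r, u) := a) \<in> tie_event u u'" and 2: "w((r, u) := b) \<in> tie_event u u'" and ab: "a < b"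
  shows False
proof -
  let ?A = "escape_le_all adj (w((r, u) := a)) r u" and ?B = "escape_le_all adj (w((r, u) := b)) r u"
  have same: "?A q \<longleftrightarrow> ?B q" if "q \<in> \<rat>" for q
  proof -
    have "escape_le_all adj (w((r, u) := a)) r u' q \<longleftrightarrow> escape_le_all adj (w((r, u) := b)) r u' q"
      using escape_le_root_upd_other[OF uu] by (simp add: escape_le_all_def)
    then show ?thesis using 1 2 that by (simp add: tie_event_def)
  qed
  have shift: "?B t \<longleftrightarrow> ?A (t - (b - a))" for t
    using escape_le_root_upd_shift[OF uu(1), of w b _ "t - b" a] by (simp add: escape_le_all_def algebra_simps)
  obtain q0 where q0: "q0 \<in> \<rat>" "?B q0" using 2 by (auto simp: tie_event_def)
  \<comment> \<open>Two tying values would make the set of rational bounds invariant under the shift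
    by \<open>b - a\<close>, and it could be lowered below \<open>b\<close>. The shift need not be
    rational; descending by half of it leaves room for a rational bound.\<close>
  define d where "d = (b - a) / 2"
  have d: "0 < d" using ab by (simp add: d_def)
  have "\<exists>q\<in>\<rat>. ?B q \<and> q \<le> q0 - real k * d" for k
  proof (induction k)
    case 0
    have "q0 \<le> q0 - real 0 * d" by simp
    then show ?case using q0 by blast
  next
    case (Suc k)
    then obtain q where q: "q \<in> \<rat>" "?B q" "q \<le> q0 - real k * d" by blast
    have "b - a = 2 * d" by (simp add: d_def)
    then have "q - (b - a) < q - d" using d by linarith
    then obtain q' where q': "q' \<in> \<rat>" "q - (b - a) < q'" "q' < q - d"
      using Rats_dense_in_real by blast
    have "?A q'" using q q' shift escape_le_all_mono by (metis less_imp_le)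
    then have "?B q'" using same q' by blast
    moreover have "q' \<le> q0 - real (Suc k) * d" using q q' by (simp add: distrib_right)
    ultimately show ?case using q' by blast
  qed
  moreover obtain k where "q0 - b < real k * d" using reals_Archimedean3[OF d] by blast
  ultimately obtain q where q: "?B q" "q \<le> q0 - real k * d" by blast
  then have "b \<le> q" unfolding escape_le_all_def by (metis escape_le.simps(1) fun_upd_same)
  then show False using q \<open>q0 - b < real k * d\<close> by linarith
qed

lemma AE_no_tie:
  assumes uu: "adj r u" "adj r u'" "u' \<noteq> u"
  shows "AE w in exp_weights adj. w \<notin> tie_event u u'"
proof -
  let ?P = "exp_weights adj" and ?T = "tie_event u u'"
  have T: "?T \<in> sets ?P" by (rule tie_event_sets[OF uu(1,2)])
  have "emeasure ?P ?T = (\<integral>\<^sup>+w. indicator ?T w \<partial>?P)" using T by simp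
  also have "\<dots> = (\<integral>\<^sup>+w. \<integral>\<^sup>+a. indicator ?T (w((r, u) := a)) \<partial>exp1 \<partial>?P)"
    using uu T by (intro nn_integral_resample) auto
  also have "\<dots> = (\<integral>\<^sup>+w. 0 \<partial>?P)"
  proof (intro nn_integral_cong)
    fix w
    have "\<exists>c. \<forall>a. w((r, u) := a) \<in> ?T \<longrightarrow> a = c"
      using tie_event_section[OF uu] by (metis linorder_neqE_linordered_idom)
    then obtain c where c: "\<And>a. w((r, u) := a) \<in> ?T \<Longrightarrow> a = c" by blast
    have "(\<integral>\<^sup>+a. indicator ?T (w((r, u) := a)) \<partial>exp1) = (\<integral>\<^sup>+a. 0 \<partial>exp1)"
      by (rule nn_integral_cong_AE, use AE_exp1_neq[of c] in eventually_elim)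
        (use c in \<open>auto simp: indicator_def simp del: fun_upd_apply\<close>)
    then show "(\<integral>\<^sup>+a. indicator ?T (w((r, u) := a)) \<partial>exp1) = 0" by simp
  qed
  finally have "?T \<in> null_sets ?P" using T by auto
  then show ?thesis by (rule AE_not_in)
qed

text \<open>A best neighbour is one whose set of rational bounds is maximal under inclusion, which
  avoids infima of possibly infinite costs. Without ties, each other neighbour misses some rational
  bound of the best one.\<close>

lemma unique_best_escape:
  assumes esc: "can_escape adj w r" and w: "w \<in> space (exp_weights adj)"
    and no_tie: "\<And>u u'. adj r u \<Longrightarrow> adj r u' \<Longrightarrow> u' \<noteq> u \<Longrightarrow> w \<notin> tie_event u u'"
  shows "\<exists>u t. adj r u \<and> escape_le_all adj w r u t \<and>
    (\<forall>u'. adj r u' \<longrightarrow> u' \<noteq> u \<longrightarrow> \<not> escape_le_all adj w r u' t)"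
proof -
  let ?R = "\<lambda>u. {q \<in> \<rat>. escape_le_all adj w r u q}"
  let ?N = "{u. adj r u \<and> ?R u \<noteq> {}}"
  have finN: "finite ?N" using finite_nbrs[OF root_in] by (rule rev_finite_subset) auto
  obtain u0 t0 where u0: "adj r u0" "escape_le_all adj w r u0 t0" using esc by (auto simp: can_escape_def)
  obtain q where "q \<in> \<rat>" "t0 < q" using Rats_dense_in_real[of t0 "t0 + 1"] by auto
  then have "q \<in> ?R u0" using escape_le_all_mono[OF u0(2), of q] by simp
  then have "u0 \<in> ?N" using u0(1) by blast
  then have ne: "?R ` ?N \<noteq> {}" by blast
  obtain u where u: "u \<in> ?N" "\<And>u'. u' \<in> ?N \<Longrightarrow> ?R u \<subseteq> ?R u' \<Longrightarrow> ?R u' = ?R u"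
  proof -
    obtain m where m: "m \<in> ?R ` ?N" "\<forall>b\<in>?R ` ?N. m \<le> b \<longrightarrow> m = b"
      using finite_has_maximal[OF finite_imageI[OF finN] ne] by blast
    then obtain u where "u \<in> ?N" "m = ?R u" by blast
    then show ?thesis using m(2) that[of u] by blast
  qed
  have "\<exists>q. q \<in> ?R u \<and> q \<notin> ?R u'" if u': "adj r u'" "u' \<noteq> u" for u'
  proof (rule ccontr)
    assume "\<not> ?thesis"
    then have sub: "?R u \<subseteq> ?R u'" by blast
    then have "u' \<in> ?N" using u u' by auto
    then have eq: "?R u' = ?R u" using u sub by blast
    then have "w \<in> tie_event u u'" using u w unfolding tie_event_def by blast
    then show False using no_tie u u' by blast
  qed
  then have "\<forall>u'\<in>{u'. adj r u'}. \<exists>q. u' \<noteq> u \<longrightarrow> q \<in> ?R u \<and> q \<notin> ?R u'" by blast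
  from bchoice[OF this] obtain Q where
    Q: "\<And>u'. adj r u' \<Longrightarrow> u' \<noteq> u \<Longrightarrow> Q u' \<in> ?R u \<and> Q u' \<notin> ?R u'" by blast
  obtain q1 where q1: "q1 \<in> ?R u" using u by blast
  \<comment> \<open>Bounds are upward closed, so the smallest separating bound excludes all other
    neighbours at once; \<open>q1\<close> keeps the set nonempty when there are none.\<close>
  let ?F = "insert q1 (Q ` {u'. adj r u' \<and> u' \<noteq> u})"
  have finF: "finite ?F" using finite_nbrs[OF root_in] by auto
  have "?F \<subseteq> ?R u" using Q q1 by blast
  then have "Min ?F \<in> ?R u" using Min_in[OF finF] by blast
  moreover have "\<not> escape_le_all adj w r u' (Min ?F)" if "adj r u'" "u' \<noteq> u" for u'
  proof
    assume "escape_le_all adj w r u' (Min ?F)"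
    moreover have "Min ?F \<le> Q u'" using finF that by (intro Min_le) auto
    ultimately have "escape_le_all adj w r u' (Q u')" by (rule escape_le_all_mono)
    then show False using Q[OF that] by auto
  qed
  ultimately show ?thesis using u by blast
qed

lemma AE_eventually_out:
  assumes "AE w in exp_weights adj. can_escape adj w r"
  shows "AE w in exp_weights adj. \<exists>u. \<forall>Vs. exhaustion V Vs \<longrightarrow> MSA_eventually_out adj w Vs r u"
proof -
  have "AE w in exp_weights adj. \<forall>u\<in>{u. adj r u}. \<forall>u'\<in>{u'. adj r u'}. u' \<noteq> u \<longrightarrow> w \<notin> tie_event u u'"
    using finite_nbrs[OF root_in] AE_no_tie by (intro AE_finite_allI) auto
  then show ?thesis using assms AE_space
  proof eventually_elim
    case (elim w)
    then obtain u t where "adj r u" "escape_le_all adj w r u t"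
      "\<And>u'. adj r u' \<Longrightarrow> u' \<noteq> u \<Longrightarrow> \<not> escape_le_all adj w r u' t"
      using unique_best_escape[of w] by auto
    then show ?case using eventually_out_root by blast
  qed
qed

end

text \<open>The limiting edge is chosen before the exhaustion, so one almost sure event yields both
  the convergence and the independence of the exhaustion.\<close>

theorem (in flow_tree) wired_limit_exists:
  assumes inf: "infinite V"
  shows "wired_MSA_limit_exists V adj (exp_weights adj)"
proof -
  have *: "AE w in exp_weights adj. \<exists>u. \<forall>Vs. exhaustion V Vs \<longrightarrow> MSA_eventually_out adj w Vs v u"
    if v: "v \<in> V" for v
  proof -
    obtain p where "rooted_tree V adj v p" using reroot[OF v] by blast
    moreover have "AE w in exp_weights adj. can_escape adj w v"
      using AE_can_escape_root by eventually_elim (use can_escape_all v in blast)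
    ultimately show ?thesis by (rule rooted_tree.AE_eventually_out)
  qed
  show ?thesis
    unfolding wired_MSA_limit_exists_def
  proof (intro conjI allI impI ballI)
    fix Vs v assume "exhaustion V Vs" "v \<in> V"
    show "AE w in exp_weights adj. \<exists>u. MSA_eventually_out adj w Vs v u"
      using *[OF \<open>v \<in> V\<close>] by (rule AE_mp) (use \<open>exhaustion V Vs\<close> in \<open>intro AE_I2, blast\<close>)
  next
    fix Vs Ws v assume Vs: "exhaustion V Vs" and Ws: "exhaustion V Ws" and v: "v \<in> V"
    show "AE w in exp_weights adj. \<forall>u u'. MSA_eventually_out adj w Vs v u \<longrightarrow>
        MSA_eventually_out adj w Ws v u' \<longrightarrow> u = u'"
      using *[OF v]
    proof eventually_elim
      case (elim w)
      then obtain z where "MSA_eventually_out adj w Vs v z" "MSA_eventually_out adj w Ws v z"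
        using Vs Ws by blast
      then show ?case
        using eventually_out_unique[OF Vs inf v] eventually_out_unique[OF Ws inf v] by metis
    qed
  qed
qed

section \<open>Trees as rooted trees\<close>

text \<open>An edge that does not follow the parent map closes a cycle with the parent chains of its
  two ends, cut where they first meet.\<close>

lemma adj_iff_parent:
  fixes par :: "'v \<Rightarrow> 'v"
  assumes tree: "is_tree V adj" and xy: "adj x y" and r: "par r = r"
    and par: "\<And>z. z \<in> V \<Longrightarrow> z \<noteq> r \<Longrightarrow> adj z (par z)"
    and reach: "\<And>z. z \<in> V \<Longrightarrow> \<exists>n. (par ^^ n) z = r"
  shows "(x \<noteq> r \<and> y = par x) \<or> (y \<noteq> r \<and> x = par y)"
proof (rule ccontr)
  assume neg: "\<not> ?thesis"
  have sg: "simple_graph V adj" and nc: "\<not> has_cycle adj" using tree by (auto simp: is_tree_def)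
  have xV: "x \<in> V" "y \<in> V" "x \<noteq> y" "adj y x" using sg xy unfolding simple_graph_def by blast+
  \<comment> \<open>Minimising the total length \<open>n + m\<close> makes each chain free of
    repetitions and the two chains disjoint before the meeting point.\<close>
  let ?Q = "\<lambda>k. \<exists>n m. n + m = k \<and> (par ^^ n) x = (par ^^ m) y"
  obtain n0 m0 where "(par ^^ n0) x = r" "(par ^^ m0) y = r" using reach xV by blast
  then have "?Q (n0 + m0)" by force
  define k where "k = (LEAST k. ?Q k)"
  have "?Q k" unfolding k_def by (rule LeastI) fact
  then obtain n m where nm: "n + m = k" "(par ^^ n) x = (par ^^ m) y" by blast
  have least: "n + m \<le> i + j" if "(par ^^ i) x = (par ^^ j) y" for i j
    unfolding nm(1) k_def by (rule Least_le) (use that in blast)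
  have add: "(par ^^ (i + d)) z = (par ^^ d) ((par ^^ i) z)" for i d z
    by (simp add: funpow_add add.commute)
  have injx: "(par ^^ i) x \<noteq> (par ^^ j) x" if "i < j" "j \<le> n" for i j
  proof
    assume eq: "(par ^^ i) x = (par ^^ j) x"
    have "(par ^^ (i + (n - j))) x = (par ^^ (j + (n - j))) x" unfolding add eq ..
    also have "\<dots> = (par ^^ m) y" using that nm by simp
    finally show False using least[of "i + (n - j)" m] that by simp
  qed
  have injy: "(par ^^ i) y \<noteq> (par ^^ j) y" if "i < j" "j \<le> m" for i j
  proof
    assume eq: "(par ^^ i) y = (par ^^ j) y"
    have "(par ^^ (i + (m - j))) y = (par ^^ (j + (m - j))) y" unfolding add eq ..
    also have "\<dots> = (par ^^ n) x" using that nm by simp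
    finally show False using least[of n "i + (m - j)"] that by simp
  qed
  have nr: "(par ^^ i) x \<noteq> r" if "i < n" for i
    using injx[of i "Suc i"] that r by auto
  have mr: "(par ^^ i) y \<noteq> r" if "i < m" for i
    using injy[of i "Suc i"] that r by auto
  have parV: "par z \<in> V" if "z \<in> V" for z
    using par[OF that] that r sg unfolding simple_graph_def by (cases "z = r") auto
  have inV: "(par ^^ i) z \<in> V" if "z \<in> V" for i z
    using that by (induction i) (auto intro: parV)
  have two: "2 \<le> n + m"
  proof (rule ccontr)
    assume "\<not> 2 \<le> n + m"
    then consider "n = 0" "m = 0" | "n = 1" "m = 0" | "n = 0" "m = 1" by linarith
    then show False
      using nm neg xV nr[of 0] mr[of 0] by cases auto
  qed
  \<comment> \<open>Up from \<open>x\<close> to the meeting point, then down to \<open>y\<close>;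
    the meeting point belongs to the first half only, hence \<open>Suc n\<close> against
    \<open>m\<close>.\<close>
  define xs where "xs = map (\<lambda>i. (par ^^ i) x) [0..<Suc n] @ rev (map (\<lambda>j. (par ^^ j) y) [0..<m])"
  have len: "length xs = Suc n + m" by (simp add: xs_def)
  then have ne: "xs \<noteq> []" by auto
  have nth1: "xs ! i = (par ^^ i) x" if "i \<le> n" for i
    using that by (simp add: xs_def nth_append del: upt_Suc)
  have nth2: "xs ! (Suc n + i) = (par ^^ (m - Suc i)) y" if "i < m" for i
    using that by (simp add: xs_def nth_append rev_nth del: upt_Suc)
  have "distinct xs"
    unfolding xs_def
  proof (simp only: distinct_append distinct_rev, intro conjI)
    show "distinct (map (\<lambda>i. (par ^^ i) x) [0..<Suc n])"
      unfolding distinct_map inj_on_def using injx by (metis atLeastLessThan_upt atLeastLessThan_iff distinct_upt less_Suc_eq_le linorder_neqE_nat)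
    show "distinct (map (\<lambda>j. (par ^^ j) y) [0..<m])"
      unfolding distinct_map inj_on_def using injy by (metis atLeastLessThan_upt atLeastLessThan_iff distinct_upt less_imp_le linorder_neqE_nat)
    show "set (map (\<lambda>i. (par ^^ i) x) [0..<Suc n]) \<inter> set (rev (map (\<lambda>j. (par ^^ j) y) [0..<m])) = {}"
    proof -
      have "(par ^^ i) x \<noteq> (par ^^ j) y" if "i \<in> set [0..<Suc n]" "j \<in> set [0..<m]" for i j
        using least[of i j] that by auto
      then show ?thesis unfolding set_map set_rev by blast
    qed
  qed
  moreover have "adj (xs ! i) (xs ! Suc i)" if i: "Suc i < length xs" for i
  proof -
    consider "i < n" | "i = n" | l where "i = Suc n + l" "Suc l < m"
      using i len by (metis add_Suc add_less_cancel_left less_iff_Suc_add less_linear add_Suc_right)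
    then show ?thesis
    proof cases
      case 1
      then have "adj ((par ^^ i) x) (par ((par ^^ i) x))" using par nr inV xV by blast
      then show ?thesis using 1 nth1[of i] nth1[of "Suc i"] by simp
    next
      case 2
      then have "0 < m" using i len by simp
      then have "adj ((par ^^ (m - 1)) y) (par ((par ^^ (m - 1)) y))" using par mr inV xV by simp
      moreover have "par ((par ^^ (m - 1)) y) = (par ^^ m) y" using \<open>0 < m\<close> by (cases m) auto
      ultimately have "adj ((par ^^ m) y) ((par ^^ (m - 1)) y)" using sg unfolding simple_graph_def by metis
      then show ?thesis using 2 nth1[of n] nth2[of 0] \<open>0 < m\<close> nm by simp
    next
      case 3
      define j where "j = m - Suc (Suc l)"
      have j: "m - Suc l = Suc j" "j < m" using 3 by (auto simp: j_def)
      have "adj ((par ^^ j) y) (par ((par ^^ j) y))" using par mr[OF j(2)] inV xV by blast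
      then have "adj (par ((par ^^ j) y)) ((par ^^ j) y)" using sg unfolding simple_graph_def by blast
      then show ?thesis using 3 nth2[of l] nth2[of "Suc l"] j by (simp add: j_def)
    qed
  qed
  moreover have "hd xs = x" using nth1[of 0] ne by (simp add: hd_conv_nth)
  moreover have "last xs = y"
  proof (cases "m = 0")
    case True
    then show ?thesis using nth1[of n] nm len ne by (simp add: last_conv_nth)
  next
    case False
    then show ?thesis using nth2[of "m - 1"] len ne by (simp add: last_conv_nth)
  qed
  ultimately have "has_cycle adj"
    unfolding has_cycle_def using len two xV by (intro exI[of _ xs]) auto
  then show False using nc by blast
qed

lemma rooted_tree_if_tree:
  assumes tree: "is_tree V adj" and lf: "locally_finite_graph V adj" and r: "r \<in> V"
  shows "\<exists>par. rooted_tree V adj r par"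
proof -
  have sg: "simple_graph V adj" using tree by (auto simp: is_tree_def)
  let ?R = "{(a, b). adj a b}"
  define d where "d z = (LEAST n. (r, z) \<in> ?R ^^ n)" for z
  have d: "(r, z) \<in> ?R ^^ d z" if "z \<in> V" for z
  proof -
    have "(r, z) \<in> ?R\<^sup>*" using tree r that by (auto simp: is_tree_def connected_graph_def)
    then obtain n where "(r, z) \<in> ?R ^^ n" using rtrancl_imp_relpow by blast
    then show ?thesis unfolding d_def by (rule LeastI)
  qed
  have ex: "\<exists>y. adj z y \<and> d y < d z" if z: "z \<in> V" "z \<noteq> r" for z
  proof -
    have "d z \<noteq> 0" using d[OF z(1)] z(2) by (intro notI) simp
    then obtain k where k: "d z = Suc k" by (cases "d z") auto
    then obtain y where y: "(r, y) \<in> ?R ^^ k" "adj y z" using d[OF z(1)] by auto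
    have "d y \<le> k" unfolding d_def by (rule Least_le) (rule y(1))
    moreover have "adj z y" using y(2) sg unfolding simple_graph_def by blast
    ultimately show ?thesis using k by (intro exI[of _ y]) simp
  qed
  \<comment> \<open>Any neighbour strictly closer to \<open>r\<close> will do. The value at
    \<open>r\<close> makes the chains stationary there, as \<open>adj_iff_parent\<close>
    requires.\<close>
  define par where "par z = (if z = r then r else SOME y. adj z y \<and> d y < d z)" for z
  have par: "adj z (par z)" "d (par z) < d z" if "z \<in> V" "z \<noteq> r" for z
    using someI_ex[OF ex[OF that]] that by (auto simp: par_def)
  have parV: "par z \<in> V" if "z \<in> V" for z
    using par[OF that] that sg unfolding simple_graph_def by (cases "z = r") (auto simp: par_def)
  have reach: "\<exists>n. (par ^^ n) z = r" if "z \<in> V" for z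
    using that
  proof (induction "d z" arbitrary: z rule: less_induct)
    case less
    show ?case
    proof (cases "z = r")
      case True
      then show ?thesis by (intro exI[of _ 0]) simp
    next
      case False
      then obtain n where "(par ^^ n) (par z) = r" using less par parV by blast
      then have "(par ^^ Suc n) z = r" by (simp add: funpow_Suc_right del: funpow.simps(2))
      then show ?thesis by blast
    qed
  qed
  have "rooted_tree V adj r par"
  proof
    show "r \<in> V" by fact
    show "par x \<in> V" if "x \<in> V" "x \<noteq> r" for x using parV that by blast
    show "\<exists>n. (par ^^ n) x = r" if "x \<in> V" for x using reach that .
    show "finite {y. adj x y}" if "x \<in> V" for x using lf that by (auto simp: locally_finite_graph_def)
    show "adj x y \<longleftrightarrow> x \<in> V \<and> y \<in> V \<and> (x \<noteq> r \<and> y = par x \<or> y \<noteq> r \<and> x = par y)" for x y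
    proof
      assume a: "adj x y"
      then have "x \<in> V" "y \<in> V" using sg unfolding simple_graph_def by blast+
      moreover have "par r = r" by (simp add: par_def)
      ultimately show "x \<in> V \<and> y \<in> V \<and> (x \<noteq> r \<and> y = par x \<or> y \<noteq> r \<and> x = par y)"
        using adj_iff_parent[OF tree a _ par(1) reach] by blast
    next
      assume "x \<in> V \<and> y \<in> V \<and> (x \<noteq> r \<and> y = par x \<or> y \<noteq> r \<and> x = par y)"
      then show "adj x y" using par(1) sg unfolding simple_graph_def by blast
    qed
  qed
  then show ?thesis by blast
qed

section \<open>A flow of finite energy on a transient tree\<close>

text \<open>The unit current flow, with the probability of hitting the root as voltage.\<close>

context rooted_tree
begin

text \<open>What remains of a first-return walk once its first step is removed; unlike there, the
  starting vertex must also avoid \<open>r\<close> unless \<open>n = 0\<close>.\<close>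

definition first_hit_walks :: "'v \<Rightarrow> nat \<Rightarrow> 'v list set" where
  "first_hit_walks x n = {xs. length xs = Suc n \<and> xs ! 0 = x \<and> xs ! n = r \<and>
     (\<forall>i<n. adj (xs ! i) (xs ! Suc i)) \<and> (\<forall>i<n. xs ! i \<noteq> r)}"

fun first_hit :: "nat \<Rightarrow> 'v \<Rightarrow> real" where
  "first_hit 0 x = (if x = r then 1 else 0)"
| "first_hit (Suc n) x = (if x = r then 0 else (\<Sum>y | adj x y. first_hit n y) / degree adj x)"

fun hit_within :: "nat \<Rightarrow> 'v \<Rightarrow> real" where
  "hit_within 0 x = (if x = r then 1 else 0)"
| "hit_within (Suc n) x = (if x = r then 1 else (\<Sum>y | adj x y. hit_within n y) / degree adj x)"

lemma all_less_Suc_shift: "(\<forall>i<Suc n. P i) \<longleftrightarrow> P 0 \<and> (\<forall>i<n. P (Suc i))"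
  using less_Suc_eq_0_disj by auto

lemma first_hit_walks_0: "first_hit_walks x 0 = (if x = r then {[r]} else {})"
  by (auto simp: first_hit_walks_def length_Suc_conv)

lemma first_hit_walks_Suc:
  assumes "x \<noteq> r"
  shows "first_hit_walks x (Suc n) = (\<Union>y\<in>{y. adj x y}. (#) x ` first_hit_walks y n)"
proof (intro subset_antisym subsetI)
  fix xs assume xs: "xs \<in> first_hit_walks x (Suc n)"
  then obtain ys where "xs = x # ys" "length ys = Suc n"
    by (auto simp: first_hit_walks_def length_Suc_conv)
  then show "xs \<in> (\<Union>y\<in>{y. adj x y}. (#) x ` first_hit_walks y n)"
    using xs by (auto simp: first_hit_walks_def all_less_Suc_shift simp del: all_simps)
next
  fix xs assume "xs \<in> (\<Union>y\<in>{y. adj x y}. (#) x ` first_hit_walks y n)"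
  then show "xs \<in> first_hit_walks x (Suc n)"
    using assms by (auto simp: first_hit_walks_def all_less_Suc_shift)
qed

lemma first_return_walks_Suc:
  "first_return_walks adj r (Suc n) = (\<Union>y\<in>{y. adj r y}. (#) r ` first_hit_walks y n)"
proof (intro subset_antisym subsetI)
  fix xs assume xs: "xs \<in> first_return_walks adj r (Suc n)"
  then obtain ys where ys: "xs = r # ys" "length ys = Suc n"
    by (auto simp: first_return_walks_def length_Suc_conv)
  have "ys ! i \<noteq> r" if "i < n" for i
    using xs that unfolding first_return_walks_def ys(1) by force
  then show "xs \<in> (\<Union>y\<in>{y. adj r y}. (#) r ` first_hit_walks y n)"
    using xs ys by (auto simp: first_return_walks_def first_hit_walks_def all_less_Suc_shift)
next
  fix xs assume "xs \<in> (\<Union>y\<in>{y. adj r y}. (#) r ` first_hit_walks y n)"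
  then obtain y ys where ys: "xs = r # ys" "adj r y" "ys \<in> first_hit_walks y n" by blast
  have "xs ! i \<noteq> r" if "0 < i" "i < Suc n" for i
    using ys that by (cases i) (auto simp: first_hit_walks_def)
  then show "xs \<in> first_return_walks adj r (Suc n)"
    using ys by (auto simp: first_return_walks_def first_hit_walks_def all_less_Suc_shift)
qed

lemma finite_first_hit_walks: "finite (first_hit_walks x n)"
proof (induction n arbitrary: x)
  case (Suc n)
  show ?case
  proof (cases "x = r")
    case True
    then have "first_hit_walks x (Suc n) = {}" by (auto simp: first_hit_walks_def)
    then show ?thesis by simp
  next
    case False
    then show ?thesis using Suc finite_nbrs' by (simp add: first_hit_walks_Suc)
  qed
qed (simp add: first_hit_walks_0)

lemma sum_walks_Cons:
  "(\<Sum>xs\<in>(\<Union>y\<in>{y. adj x y}. (#) x ` first_hit_walks y n). \<Prod>i<Suc n. 1 / real (degree adj (xs ! i))) =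
   (\<Sum>y | adj x y. \<Sum>xs\<in>first_hit_walks y n. \<Prod>i<n. 1 / real (degree adj (xs ! i))) / degree adj x"
proof -
  have "(\<Sum>xs\<in>(\<Union>y\<in>{y. adj x y}. (#) x ` first_hit_walks y n). \<Prod>i<Suc n. 1 / real (degree adj (xs ! i))) =
      (\<Sum>y | adj x y. \<Sum>xs\<in>(#) x ` first_hit_walks y n. \<Prod>i<Suc n. 1 / real (degree adj (xs ! i)))"
    using finite_nbrs' finite_first_hit_walks
    by (intro sum.UNION_disjoint) (auto simp: first_hit_walks_def)
  also have "\<dots> = (\<Sum>y | adj x y. (\<Sum>xs\<in>first_hit_walks y n. \<Prod>i<n. 1 / real (degree adj (xs ! i))) / degree adj x)"
    by (intro sum.cong refl, subst sum.reindex)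
      (auto simp: prod.lessThan_Suc_shift sum_divide_distrib simp del: prod.lessThan_Suc)
  finally show ?thesis by (simp add: sum_divide_distrib)
qed

lemma first_hit_eq: "first_hit n x = (\<Sum>xs\<in>first_hit_walks x n. \<Prod>i<n. 1 / real (degree adj (xs ! i)))"
proof (induction n arbitrary: x)
  case (Suc n)
  show ?case
  proof (cases "x = r")
    case True
    then have "first_hit_walks x (Suc n) = {}" by (auto simp: first_hit_walks_def)
    then show ?thesis using True by simp
  next
    case False
    then show ?thesis using Suc by (simp add: first_hit_walks_Suc sum_walks_Cons del: prod.lessThan_Suc)
  qed
qed (simp add: first_hit_walks_0)

lemma sum_first_return:
  "(\<Sum>xs\<in>first_return_walks adj r (Suc n). \<Prod>i<Suc n. 1 / real (degree adj (xs ! i))) =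
   (\<Sum>y | adj r y. first_hit n y) / degree adj r"
  unfolding first_return_walks_Suc sum_walks_Cons first_hit_eq ..

text \<open>Both sides obey the recursion given by the first step. The series in
  \<open>return_prob\<close> thereby becomes a limit of the monotone, bounded sequences
  \<open>hit_within\<close>.\<close>

lemma sum_first_hit: "(\<Sum>n\<le>m. first_hit n x) = hit_within m x"
proof (induction m arbitrary: x)
  case (Suc m)
  have "(\<Sum>n\<le>Suc m. first_hit n x) = first_hit 0 x + (\<Sum>n\<le>m. first_hit (Suc n) x)"
    by (rule sum.atMost_Suc_shift)
  also have "\<dots> = hit_within (Suc m) x"
  proof (cases "x = r")
    case False
    have "(\<Sum>n\<le>m. first_hit (Suc n) x) = (\<Sum>n\<le>m. \<Sum>y | adj x y. first_hit n y) / degree adj x"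
      using False by (simp add: sum_divide_distrib)
    also have "(\<Sum>n\<le>m. \<Sum>y | adj x y. first_hit n y) = (\<Sum>y | adj x y. hit_within m y)"
      by (subst sum.swap) (simp add: Suc)
    finally show ?thesis using False by simp
  qed simp
  finally show ?case .
qed simp

lemma sum_nbrs: "x \<in> V \<Longrightarrow> x \<noteq> r \<Longrightarrow> (\<Sum>y | adj x y. F y) = F (par x) + (\<Sum>c\<in>ch x. F c)"
  for F :: "'v \<Rightarrow> real"
  using nbrs_eq par_notin_ch finite_ch by simp

lemma degree_eq: "x \<in> V \<Longrightarrow> x \<noteq> r \<Longrightarrow> degree adj x = Suc (card (ch x))"
  using nbrs_eq par_notin_ch finite_ch by (simp add: degree_def)

lemma average_le:
  assumes "x \<in> V" "x \<noteq> r" "\<And>y. adj x y \<Longrightarrow> F y \<le> (B :: real)"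
  shows "(\<Sum>y | adj x y. F y) / degree adj x \<le> B"
proof -
  have "(\<Sum>y | adj x y. F y) \<le> real (degree adj x) * B"
    unfolding degree_def using assms(3) by (intro sum_bounded_above) auto
  moreover have "0 < real (degree adj x)" using degree_eq assms by simp
  ultimately show ?thesis by (simp add: field_simps)
qed

lemma hit_within_nonneg: "0 \<le> hit_within n x"
  by (induction n arbitrary: x) (auto intro!: divide_nonneg_nonneg sum_nonneg)

lemma hit_within_le_1: "x \<in> V \<Longrightarrow> hit_within n x \<le> 1"
proof (induction n arbitrary: x)
  case (Suc n)
  then show ?case using average_le[of x "hit_within n" 1] adj_in by auto
qed simp

lemma hit_within_Suc: "x \<in> V \<Longrightarrow> hit_within n x \<le> hit_within (Suc n) x"
proof (induction n arbitrary: x)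
  case 0
  then show ?case using hit_within_nonneg[of "Suc 0" x] by auto
next
  case (Suc n)
  then have "(\<Sum>y | adj x y. hit_within n y) \<le> (\<Sum>y | adj x y. hit_within (Suc n) y)"
    using adj_in by (intro sum_mono) auto
  then have "(\<Sum>y | adj x y. hit_within n y) / degree adj x \<le> (\<Sum>y | adj x y. hit_within (Suc n) y) / degree adj x"
    by (rule divide_right_mono) simp
  then show ?case by (cases "x = r") simp_all
qed

text \<open>The walk from \<open>c\<close> has to pass through its parent. In the induction every
  neighbour of \<open>c\<close> has at most the value of \<open>par c\<close>, a child by two uses
  of the hypothesis; averaging costs one time step, which monotonicity in \<open>n\<close>
  restores.\<close>

lemma hit_within_par: "c \<in> V \<Longrightarrow> c \<noteq> r \<Longrightarrow> hit_within n c \<le> hit_within n (par c)"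
proof (induction n arbitrary: c)
  case 0
  then show ?case by simp
next
  case (Suc n)
  have "hit_within n y \<le> hit_within n (par c)" if "adj c y" for y
    using adj_cases[OF that] Suc chD by (metis order_refl order_trans)
  then have "hit_within (Suc n) c \<le> hit_within n (par c)"
    using average_le[of c "hit_within n"] Suc.prems by simp
  then show ?case using hit_within_Suc[OF par_in[OF Suc.prems], of n] by linarith
qed

definition hit_prob :: "'v \<Rightarrow> real" where
  "hit_prob x = lim (\<lambda>n. hit_within n x)"

lemma hit_within_tendsto:
  assumes "x \<in> V"
  shows "(\<lambda>n. hit_within n x) \<longlonglongrightarrow> hit_prob x"
proof -
  have "incseq (\<lambda>n. hit_within n x)" using hit_within_Suc[OF assms] by (rule incseq_SucI)
  then obtain L where "(\<lambda>n. hit_within n x) \<longlonglongrightarrow> L"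
    using incseq_convergent[of "\<lambda>n. hit_within n x" 1] hit_within_le_1[OF assms] by blast
  then show ?thesis unfolding hit_prob_def by (simp add: limI)
qed

lemma hit_prob_root: "hit_prob r = 1"
proof -
  have "hit_within n r = 1" for n by (cases n) auto
  then show ?thesis using LIMSEQ_unique[OF hit_within_tendsto[OF root_in]] by simp
qed

lemma hit_prob_nonneg: "x \<in> V \<Longrightarrow> 0 \<le> hit_prob x"
  using LIMSEQ_le_const[OF hit_within_tendsto] hit_within_nonneg by blast

lemma hit_prob_par: "c \<in> V \<Longrightarrow> c \<noteq> r \<Longrightarrow> hit_prob c \<le> hit_prob (par c)"
  using LIMSEQ_le[OF hit_within_tendsto hit_within_tendsto] hit_within_par par_in by blast

lemma hit_prob_harmonic:
  assumes "x \<in> V" "x \<noteq> r"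
  shows "real (degree adj x) * hit_prob x = (\<Sum>y | adj x y. hit_prob y)"
proof -
  have "(\<lambda>n. \<Sum>y | adj x y. hit_within n y) \<longlonglongrightarrow> (\<Sum>y | adj x y. hit_prob y)"
    using adj_in by (intro tendsto_sum hit_within_tendsto) auto
  moreover have "(\<lambda>n. \<Sum>y | adj x y. hit_within n y) = (\<lambda>n. real (degree adj x) * hit_within (Suc n) x)"
    using assms degree_eq by simp
  moreover have "(\<lambda>n. real (degree adj x) * hit_within (Suc n) x) \<longlonglongrightarrow> real (degree adj x) * hit_prob x"
    by (intro tendsto_mult_left LIMSEQ_Suc[OF hit_within_tendsto[OF assms(1)]])
  ultimately show ?thesis using LIMSEQ_unique by metis
qed

text \<open>Dividing by the degree turns the left side into the return probability, which transience
  keeps below 1.\<close>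

lemma sum_hit_prob_root:
  assumes tr: "srw_transient V adj" and ne: "{y. adj r y} \<noteq> {}"
  shows "(\<Sum>y | adj r y. hit_prob y) < real (degree adj r)"
proof -
  have deg: "0 < real (degree adj r)"
    using ne finite_nbrs' by (simp add: degree_def card_gt_0_iff)
  let ?f = "\<lambda>n. (\<Sum>y | adj r y. first_hit n y) / degree adj r"
  have sm: "summable ?f" and lt: "suminf ?f < 1"
    using bspec[OF tr[unfolded srw_transient_def] root_in]
    unfolding return_prob_def sum_first_return by blast+
  have "(\<Sum>n\<le>m. ?f n) = (\<Sum>y | adj r y. hit_within m y) / degree adj r" for m
  proof -
    have "(\<Sum>n\<le>m. ?f n) = (\<Sum>n\<le>m. \<Sum>y | adj r y. first_hit n y) / degree adj r"
      by (simp add: sum_divide_distrib)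
    then show ?thesis by (subst (asm) sum.swap) (simp add: sum_first_hit)
  qed
  then have 1: "(\<lambda>m. (\<Sum>y | adj r y. hit_within m y) / degree adj r) \<longlonglongrightarrow> suminf ?f"
    using summable_LIMSEQ'[OF sm] by simp
  have 2: "(\<lambda>m. (\<Sum>y | adj r y. hit_within m y) / degree adj r) \<longlonglongrightarrow>
      (\<Sum>y | adj r y. hit_prob y) / degree adj r"
    using adj_in by (intro tendsto_divide tendsto_sum hit_within_tendsto tendsto_const) (use deg in auto)
  have "(\<Sum>y | adj r y. hit_prob y) / degree adj r < 1"
    using lt unfolding LIMSEQ_unique[OF 1 2] .
  then show ?thesis using deg by (simp add: field_simps)
qed

lemma flow_tree_if_transient:
  assumes tr: "srw_transient V adj" and inf: "infinite V"
  shows "\<exists>\<theta> E. flow_tree V adj r par \<theta> E"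
proof -
  have ne: "{y. adj r y} \<noteq> {}"
  proof
    assume "{y. adj r y} = {}"
    then have "V \<subseteq> {r}" using reachable by (auto elim: converse_rtranclE)
    then show False using inf finite_subset by blast
  qed
  \<comment> \<open>The total current leaving the root; dividing by it normalises the flow to unit
    strength.\<close>
  define I where "I = (\<Sum>c\<in>ch r. 1 - hit_prob c)"
  have "I = real (degree adj r) - (\<Sum>y | adj r y. hit_prob y)"
    unfolding I_def ch_root degree_def by (simp add: sum_subtractf)
  then have I: "0 < I" using sum_hit_prob_root[OF tr ne] by simp
  define \<theta> where "\<theta> x = (if x = r then 1 else (hit_prob (par x) - hit_prob x) / I)" for x
  have flow: "(\<Sum>c\<in>ch x. \<theta> c) = \<theta> x" if x: "x \<in> V" for x
  proof -
    have "(\<Sum>c\<in>ch x. \<theta> c) = (\<Sum>c\<in>ch x. (hit_prob x - hit_prob c) / I)"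
      by (intro sum.cong) (auto simp: \<theta>_def dest: chD)
    also have "\<dots> = (\<Sum>c\<in>ch x. hit_prob x - hit_prob c) / I" by (simp add: sum_divide_distrib)
    also have "\<dots> = \<theta> x"
    proof (cases "x = r")
      case True
      then show ?thesis using I by (simp add: hit_prob_root I_def[symmetric] \<theta>_def)
    next
      case False
      have "real (Suc (card (ch x))) * hit_prob x = hit_prob (par x) + (\<Sum>c\<in>ch x. hit_prob c)"
        using hit_prob_harmonic[OF x False] sum_nbrs[OF x False] degree_eq[OF x False] by simp
      then have "(\<Sum>c\<in>ch x. hit_prob x - hit_prob c) = hit_prob (par x) - hit_prob x"
        by (simp add: sum_subtractf algebra_simps)
      then show ?thesis using False by (simp add: \<theta>_def)
    qed
    finally show ?thesis .
  qed
  have nonneg: "0 \<le> \<theta> x" if "x \<in> V" for x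
    using that hit_prob_par I by (simp add: \<theta>_def)
  \<comment> \<open>Discrete summation by parts: the root voltage 1 splits into the energy
    dissipated up to level \<open>n\<close>, scaled by \<open>I\<close>, and a nonnegative boundary
    term. This bounds the energy by \<open>1 / I\<close>.\<close>
  have green: "I * (\<Sum>k<n. \<Sum>c\<in>level (Suc k). (\<theta> c)\<^sup>2) + (\<Sum>x\<in>level n. hit_prob x * \<theta> x) = 1" for n
  proof (induction n)
    case 0
    then show ?case by (simp add: level_0 hit_prob_root \<theta>_def)
  next
    case (Suc n)
    have "(\<Sum>x\<in>level n. hit_prob x * \<theta> x) = (\<Sum>x\<in>level n. \<Sum>c\<in>ch x. hit_prob (par c) * \<theta> c)"
    proof (rule sum.cong)
      fix x assume "x \<in> level n"
      then have "hit_prob x * \<theta> x = (\<Sum>c\<in>ch x. hit_prob x * \<theta> c)"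
        using flow[of x] by (simp add: level_def sum_distrib_left[symmetric])
      also have "\<dots> = (\<Sum>c\<in>ch x. hit_prob (par c) * \<theta> c)" by (intro sum.cong) (auto dest: chD)
      finally show "hit_prob x * \<theta> x = (\<Sum>c\<in>ch x. hit_prob (par c) * \<theta> c)" .
    qed simp
    also have "\<dots> = (\<Sum>c\<in>level (Suc n). hit_prob (par c) * \<theta> c)" by (simp only: sum_level_Suc)
    also have "\<dots> = (\<Sum>c\<in>level (Suc n). I * (\<theta> c)\<^sup>2 + hit_prob c * \<theta> c)"
    proof (rule sum.cong)
      fix c assume "c \<in> level (Suc n)"
      then have "c \<noteq> r" by (auto simp: level_def)
      then have "hit_prob (par c) = I * \<theta> c + hit_prob c" using I by (simp add: \<theta>_def)
      then show "hit_prob (par c) * \<theta> c = I * (\<theta> c)\<^sup>2 + hit_prob c * \<theta> c"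
        by (simp add: power2_eq_square distrib_right)
    qed simp
    finally show ?case using Suc by (simp add: sum.distrib sum_distrib_left algebra_simps)
  qed
  have energy: "(\<Sum>x\<in>F. (\<theta> x)\<^sup>2) \<le> 1 / I" if F: "finite F" "F \<subseteq> V - {r}" for F
  proof -
    obtain n where n: "\<And>x. x \<in> F \<Longrightarrow> depth x \<le> n"
      using F(1) by (metis Max_ge finite_imageI imageI)
    have "F \<subseteq> (\<Union>k<n. level (Suc k))"
    proof
      fix x assume x: "x \<in> F"
      then have "x \<in> V" "depth x \<noteq> 0" using F depth_0_iff by auto
      then obtain k where "depth x = Suc k" by (cases "depth x") auto
      then show "x \<in> (\<Union>k<n. level (Suc k))" using n[OF x] \<open>x \<in> V\<close> by (auto simp: level_def)
    qed
    then have "(\<Sum>x\<in>F. (\<theta> x)\<^sup>2) \<le> (\<Sum>x\<in>(\<Union>k<n. level (Suc k)). (\<theta> x)\<^sup>2)"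
      by (intro sum_mono2) (simp_all add: finite_level)
    also have "\<dots> = (\<Sum>k<n. \<Sum>c\<in>level (Suc k). (\<theta> c)\<^sup>2)"
      by (rule sum.UNION_disjoint) (simp_all add: finite_level, auto simp: level_def)
    also have "\<dots> \<le> 1 / I"
    proof -
      have "0 \<le> (\<Sum>x\<in>level n. hit_prob x * \<theta> x)"
        by (intro sum_nonneg mult_nonneg_nonneg hit_prob_nonneg nonneg) (auto simp: level_def)
      then show ?thesis using green[of n] I by (simp add: field_simps)
    qed
    finally show ?thesis .
  qed
  have "flow_tree V adj r par \<theta> (1 / I)"
    by unfold_locales (use flow nonneg energy in \<open>auto simp: \<theta>_def\<close>)
  then show ?thesis by blast
qed

end

section \<open>Subdivisions\<close>

text \<open>The edge from \<open>y\<close> to its parent becomes the path \<open>P y\<close>, and the pairs \<open>(y, j)\<close> with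
  \<open>1 \<le> j \<le> L y\<close> address the vertices of the subdivision other than the root.\<close>

locale subdivided_flow_tree = flow_tree V adj r par \<theta> energy
  for V :: "'a set" and adj r par \<theta> energy +
  fixes \<phi> :: "'a \<Rightarrow> 'v" and P :: "'a \<Rightarrow> 'v list" and W :: "'v set" and adjW :: "'v \<Rightarrow> 'v \<Rightarrow> bool"
    and M :: nat
  assumes inj_phi: "inj_on \<phi> V"
    and len_P: "y \<in> V - {r} \<Longrightarrow> 2 \<le> length (P y) \<and> length (P y) \<le> Suc M"
    and ends_P: "y \<in> V - {r} \<Longrightarrow> hd (P y) = \<phi> (par y) \<and> last (P y) = \<phi> y"
    and distinct_P: "y \<in> V - {r} \<Longrightarrow> distinct (P y)"
    and inner_P: "y \<in> V - {r} \<Longrightarrow> set (butlast (tl (P y))) \<inter> \<phi> ` V = {}"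
    and disjoint_P: "y \<in> V - {r} \<Longrightarrow> z \<in> V - {r} \<Longrightarrow> y \<noteq> z \<Longrightarrow>
      set (butlast (tl (P y))) \<inter> set (butlast (tl (P z))) = {}"
    and W_eq: "W = \<phi> ` V \<union> (\<Union>y\<in>V - {r}. set (P y))"
    and adjW_iff: "adjW a b \<longleftrightarrow> (\<exists>y\<in>V - {r}. \<exists>i. Suc i < length (P y) \<and>
      (a = P y ! i \<and> b = P y ! Suc i \<or> b = P y ! i \<and> a = P y ! Suc i))"
begin

definition L :: "'a \<Rightarrow> nat" where
  "L y = length (P y) - 1"

definition addresses :: "('a \<times> nat) set" where
  "addresses = {(y, j). y \<in> V - {r} \<and> 1 \<le> j \<and> j \<le> L y}"

definition node :: "'a \<times> nat \<Rightarrow> 'v" where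
  "node = (\<lambda>(y, j). P y ! j)"

lemma L_bounds: "y \<in> V - {r} \<Longrightarrow> 1 \<le> L y \<and> L y \<le> M"
  using len_P[of y] unfolding L_def by linarith

lemma length_P: "y \<in> V - {r} \<Longrightarrow> length (P y) = Suc (L y)"
  using len_P[of y] unfolding L_def by linarith

lemma P_0: "y \<in> V - {r} \<Longrightarrow> P y ! 0 = \<phi> (par y)"
  using ends_P[of y] length_P[of y] by (metis hd_conv_nth length_0_conv nat.distinct(1))

lemma P_L: "y \<in> V - {r} \<Longrightarrow> P y ! L y = \<phi> y"
  using ends_P[of y] length_P[of y] by (metis last_conv_nth length_0_conv nat.distinct(1) L_def)

lemma inner_in: "y \<in> V - {r} \<Longrightarrow> 1 \<le> j \<Longrightarrow> j < L y \<Longrightarrow> P y ! j \<in> set (butlast (tl (P y)))"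
proof -
  assume y: "y \<in> V - {r}" and j: "1 \<le> j" "j < L y"
  then obtain i where i: "j = Suc i" by (cases j) auto
  have "butlast (tl (P y)) ! i = P y ! j"
    using length_P[OF y] j i by (simp add: nth_butlast nth_tl)
  moreover have "i < length (butlast (tl (P y)))" using length_P[OF y] j i by simp
  ultimately show ?thesis by (metis nth_mem)
qed

lemma node_eq_phi:
  assumes "y \<in> V - {r}" "1 \<le> j" "j \<le> L y" "z \<in> V" "P y ! j = \<phi> z"
  shows "z = y \<and> j = L y"
proof (cases "j = L y")
  case True
  then show ?thesis using P_L[of y] assms inj_phi by (auto dest: inj_onD)
next
  case False
  then show ?thesis using inner_in[of y j] inner_P[of y] assms by auto
qed

text \<open>The far ends of the paths are separated by injectivity of \<open>\<phi>\<close>, inner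
  vertices by disjointness of the interiors. Index 0 has no address because siblings share that
  vertex.\<close>

lemma inj_node: "inj_on node addresses"
proof (rule inj_onI)
  fix p q assume p: "p \<in> addresses" and q: "q \<in> addresses" and eq: "node p = node q"
  obtain y j where pe: "p = (y, j)" by fastforce
  obtain z k where qe: "q = (z, k)" by fastforce
  have y: "y \<in> V - {r}" "1 \<le> j" "j \<le> L y" and z: "z \<in> V - {r}" "1 \<le> k" "k \<le> L z"
    and e: "P y ! j = P z ! k"
    using p q eq by (auto simp: addresses_def node_def pe qe)
  show "p = q"
  proof (cases "j = L y \<or> k = L z")
    case True
    then have "y = z \<and> j = k"
    proof
      assume "j = L y"
      then have "P z ! k = \<phi> y" using P_L[OF y(1)] e by simp
      then show ?thesis using node_eq_phi[of z k y] y z \<open>j = L y\<close> by simp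
    next
      assume "k = L z"
      then have "P y ! j = \<phi> z" using P_L[OF z(1)] e by simp
      then show ?thesis using node_eq_phi[of y j z] y z \<open>k = L z\<close> by simp
    qed
    then show ?thesis using pe qe by simp
  next
    case False
    then have "P y ! j \<in> set (butlast (tl (P y)))" "P y ! j \<in> set (butlast (tl (P z)))"
      using inner_in[of y j] inner_in[of z k] y z e by auto
    then have yz: "y = z" using disjoint_P[OF y(1) z(1)] by blast
    then have "j = k"
      using nth_eq_iff_index_eq[OF distinct_P[OF y(1)], of j k] length_P[OF y(1)] y z e by simp
    then show ?thesis using yz pe qe by simp
  qed
qed

lemma node_neq_root: "p \<in> addresses \<Longrightarrow> node p \<noteq> \<phi> r"
  using node_eq_phi root_in by (fastforce simp: addresses_def node_def)

lemma W_nodes: "W = insert (\<phi> r) (node ` addresses)"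
proof (intro subset_antisym subsetI)
  fix a assume a: "a \<in> W"
  have phi: "\<phi> z \<in> insert (\<phi> r) (node ` addresses)" if "z \<in> V" for z
  proof (cases "z = r")
    case False
    then have "(z, L z) \<in> addresses" using that L_bounds by (auto simp: addresses_def)
    moreover have "node (z, L z) = \<phi> z" using that False P_L by (auto simp: node_def)
    ultimately show ?thesis by (metis imageI insertI2)
  qed simp
  from a consider z where "z \<in> V" "a = \<phi> z" | y where "y \<in> V - {r}" "a \<in> set (P y)"
    using W_eq by auto
  then show "a \<in> insert (\<phi> r) (node ` addresses)"
  proof cases
    case 2
    then obtain j where j: "j < length (P y)" "a = P y ! j" by (metis in_set_conv_nth)
    show ?thesis
    proof (cases "j = 0")
      case True
      then show ?thesis using phi[of "par y"] P_0 par_in 2 j by auto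
    next
      case False
      then have "(y, j) \<in> addresses" using 2 j length_P[of y] by (auto simp: addresses_def)
      moreover have "node (y, j) = a" using j by (simp add: node_def)
      ultimately show ?thesis by blast
    qed
  qed (use phi in auto)
next
  fix a assume "a \<in> insert (\<phi> r) (node ` addresses)"
  then show "a \<in> W"
  proof
    assume "a \<in> node ` addresses"
    then obtain y j where "y \<in> V - {r}" "j \<le> L y" "a = P y ! j"
      by (auto simp: addresses_def node_def)
    then show ?thesis using length_P[of y] unfolding W_eq by (metis UN_I UnI2 le_imp_less_Suc nth_mem)
  qed (use root_in W_eq in auto)
qed

definition address :: "'v \<Rightarrow> 'a \<times> nat" where
  "address = inv_into addresses node"

definition parW :: "'v \<Rightarrow> 'v" where
  "parW a = (case address a of (y, j) \<Rightarrow> P y ! (j - 1))"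

definition flowW :: "'v \<Rightarrow> real" where
  "flowW a = (if a = \<phi> r then 1 else \<theta> (fst (address a)))"

lemma address_node: "p \<in> addresses \<Longrightarrow> address (node p) = p"
  unfolding address_def by (rule inv_into_f_f[OF inj_node])

lemma address_nth: "y \<in> V - {r} \<Longrightarrow> 1 \<le> j \<Longrightarrow> j \<le> L y \<Longrightarrow> address (P y ! j) = (y, j)"
  using address_node[of "(y, j)"] by (simp add: addresses_def node_def)

lemma parW_nth: "y \<in> V - {r} \<Longrightarrow> 1 \<le> j \<Longrightarrow> j \<le> L y \<Longrightarrow> parW (P y ! j) = P y ! (j - 1)"
  by (simp add: parW_def address_nth)

lemma P_in_W: "y \<in> V - {r} \<Longrightarrow> j \<le> L y \<Longrightarrow> P y ! j \<in> W"
  using length_P[of y] unfolding W_eq by (metis UN_I UnI2 le_imp_less_Suc nth_mem)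

lemma P_neq_root: "y \<in> V - {r} \<Longrightarrow> 1 \<le> j \<Longrightarrow> j \<le> L y \<Longrightarrow> P y ! j \<noteq> \<phi> r"
  using node_neq_root[of "(y, j)"] by (simp add: addresses_def node_def)

lemma W_cases:
  assumes "a \<in> W"
  obtains "a = \<phi> r" | y j where "y \<in> V - {r}" "1 \<le> j" "j \<le> L y" "a = P y ! j"
  using assms unfolding W_nodes by (auto simp: addresses_def node_def)

lemma parW_funpow: "y \<in> V - {r} \<Longrightarrow> j \<le> L y \<Longrightarrow> (parW ^^ j) (P y ! j) = \<phi> (par y)"
proof (induction j)
  case 0
  then show ?case using P_0 by simp
next
  case (Suc j)
  then have "parW (P y ! Suc j) = P y ! j" using parW_nth[of y "Suc j"] by simp
  then show ?case using Suc by (simp add: funpow_Suc_right del: funpow.simps(2))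
qed

lemma parW_reach_phi: "z \<in> V \<Longrightarrow> \<exists>n. (parW ^^ n) (\<phi> z) = \<phi> r"
proof (induction "depth z" arbitrary: z rule: less_induct)
  case less
  show ?case
  proof (cases "z = r")
    case True
    then show ?thesis by (intro exI[of _ 0]) simp
  next
    case False
    then have z: "z \<in> V - {r}" using less by simp
    then obtain n where n: "(parW ^^ n) (\<phi> (par z)) = \<phi> r"
      using less depth_par[of z] par_in[of z] by auto
    have "(parW ^^ (n + L z)) (\<phi> z) = \<phi> r"
      using parW_funpow[OF z order_refl] P_L[OF z] n by (simp add: funpow_add)
    then show ?thesis by blast
  qed
qed

lemma finite_nbrsW:
  assumes "a \<in> W"
  shows "finite {b. adjW a b}"
proof -
  \<comment> \<open>A vertex lies on the path of its own address or, if it is an original vertex, at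
    the start of the paths of its children. Where \<open>address\<close> or \<open>inv_into\<close>
    is arbitrary, it merely enlarges a finite set.\<close>
  let ?Y = "insert (fst (address a)) (ch (inv_into V \<phi> a)) \<inter> (V - {r})"
  have "{b. adjW a b} \<subseteq> (\<Union>y\<in>?Y. set (P y))"
  proof
    fix b assume "b \<in> {b. adjW a b}"
    then obtain y i where y: "y \<in> V - {r}" "Suc i < length (P y)"
      and ab: "a = P y ! i \<and> b = P y ! Suc i \<or> b = P y ! i \<and> a = P y ! Suc i"
      unfolding adjW_iff by blast
    then obtain j where j: "j < length (P y)" "a = P y ! j" and b: "b \<in> set (P y)"
      by (metis Suc_lessD nth_mem)
    have "y \<in> ?Y"
    proof (cases "j = 0")
      case True
      then have "a = \<phi> (par y)" using P_0 y j by simp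
      then have "inv_into V \<phi> a = par y" using inj_phi par_in y by simp
      then show ?thesis using y by (auto simp: ch_def)
    next
      case False
      then have "address a = (y, j)" using address_nth[OF y(1), of j] j length_P[OF y(1)] by simp
      then show ?thesis using y by simp
    qed
    then show "b \<in> (\<Union>y\<in>?Y. set (P y))" using b by blast
  qed
  moreover have "finite ?Y" using finite_ch by auto
  ultimately show ?thesis by (meson List.finite_set finite_UN finite_subset)
qed

lemma rooted_treeW: "rooted_tree W adjW (\<phi> r) parW"
proof
  show "\<phi> r \<in> W" by (simp add: W_nodes)
  show "finite {b. adjW a b}" if "a \<in> W" for a by (rule finite_nbrsW[OF that])
  show "parW a \<in> W" if "a \<in> W" "a \<noteq> \<phi> r" for a
    using that(1)
  proof (cases rule: W_cases)
    case (2 y j)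
    then show ?thesis using parW_nth P_in_W[of y "j - 1"] by simp
  qed (use that in auto)
  show "\<exists>n. (parW ^^ n) a = \<phi> r" if "a \<in> W" for a
    using that
  proof (cases rule: W_cases)
    case 1
    then show ?thesis by (intro exI[of _ 0]) simp
  next
    case (2 y j)
    obtain n where "(parW ^^ n) (\<phi> (par y)) = \<phi> r" using parW_reach_phi[of "par y"] par_in 2 by auto
    then have "(parW ^^ (n + j)) a = \<phi> r" using parW_funpow[of y j] 2 by (simp add: funpow_add)
    then show ?thesis by blast
  qed
  show "adjW a b \<longleftrightarrow> a \<in> W \<and> b \<in> W \<and> (a \<noteq> \<phi> r \<and> b = parW a \<or> b \<noteq> \<phi> r \<and> a = parW b)" for a b
  proof
    assume "adjW a b"
    then obtain y i where y: "y \<in> V - {r}" "Suc i < length (P y)"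
      and ab: "a = P y ! i \<and> b = P y ! Suc i \<or> b = P y ! i \<and> a = P y ! Suc i"
      unfolding adjW_iff by blast
    have "Suc i \<le> L y" using y length_P by simp
    then have "parW (P y ! Suc i) = P y ! i" "P y ! Suc i \<noteq> \<phi> r" "P y ! i \<in> W" "P y ! Suc i \<in> W"
      using y(1) parW_nth[of y "Suc i"] P_neq_root[of y "Suc i"] P_in_W[of y] by auto
    then show "a \<in> W \<and> b \<in> W \<and> (a \<noteq> \<phi> r \<and> b = parW a \<or> b \<noteq> \<phi> r \<and> a = parW b)"
      using ab by auto
  next
    have par: "adjW c (parW c) \<and> adjW (parW c) c" if "c \<in> W" "c \<noteq> \<phi> r" for c
      using that(1)
    proof (cases rule: W_cases)
      case (2 y j)
      then have "parW c = P y ! (j - 1)" "c = P y ! Suc (j - 1)" "Suc (j - 1) < length (P y)"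
        using parW_nth length_P[of y] by auto
      then show ?thesis unfolding adjW_iff using 2(1) by blast
    qed (use that in auto)
    assume "a \<in> W \<and> b \<in> W \<and> (a \<noteq> \<phi> r \<and> b = parW a \<or> b \<noteq> \<phi> r \<and> a = parW b)"
    then show "adjW a b" using par by blast
  qed
qed

lemma flowW_nth: "y \<in> V - {r} \<Longrightarrow> 1 \<le> j \<Longrightarrow> j \<le> L y \<Longrightarrow> flowW (P y ! j) = \<theta> y"
  by (simp add: flowW_def address_nth P_neq_root)

lemma flowW_phi: "z \<in> V \<Longrightarrow> flowW (\<phi> z) = \<theta> z"
  using flowW_nth[of z "L z"] P_L[of z] L_bounds[of z] by (cases "z = r") (auto simp: flowW_def flow_root)

text \<open>An original vertex passes its flow to the first vertices of the paths to its children;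
  an inner vertex has exactly one child, with the same flow.\<close>

lemma flowW_conservation:
  assumes a: "a \<in> W"
  shows "(\<Sum>c | c \<in> W \<and> c \<noteq> \<phi> r \<and> parW c = a. flowW c) = flowW a"
proof -
  let ?C = "{c. c \<in> W \<and> c \<noteq> \<phi> r \<and> parW c = a}"
  have C: "c \<in> ?C \<longleftrightarrow> (\<exists>y j. y \<in> V - {r} \<and> 1 \<le> j \<and> j \<le> L y \<and> c = P y ! j \<and> P y ! (j - 1) = a)" for c
  proof
    assume c: "c \<in> ?C"
    then obtain y j where y: "y \<in> V - {r}" "1 \<le> j" "j \<le> L y" "c = P y ! j"
      using W_cases[of c] by blast
    moreover have "P y ! (j - 1) = a" using parW_nth[OF y(1-3)] c y(4) by simp
    ultimately show "\<exists>y j. y \<in> V - {r} \<and> 1 \<le> j \<and> j \<le> L y \<and> c = P y ! j \<and> P y ! (j - 1) = a"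
      by blast
  next
    assume "\<exists>y j. y \<in> V - {r} \<and> 1 \<le> j \<and> j \<le> L y \<and> c = P y ! j \<and> P y ! (j - 1) = a"
    then show "c \<in> ?C" using parW_nth P_in_W P_neq_root by auto
  qed
  show ?thesis
  proof (cases "a \<in> \<phi> ` V")
    case True
    then obtain z where z: "z \<in> V" "a = \<phi> z" by blast
    have "?C = (\<lambda>y. P y ! 1) ` ch z"
    proof (intro subset_antisym subsetI)
      fix c assume "c \<in> ?C"
      then obtain y j where y: "y \<in> V - {r}" "1 \<le> j" "j \<le> L y" "c = P y ! j" "P y ! (j - 1) = a"
        using C by blast
      have "j = 1"
      proof (rule ccontr)
        assume "j \<noteq> 1"
        then have "j - 1 = L y" using node_eq_phi[of y "j - 1" z] y z by simp
        then show False using y by simp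
      qed
      moreover from this have "par y = z" using y z P_0[of y] inj_phi par_in by (auto dest: inj_onD)
      ultimately show "c \<in> (\<lambda>y. P y ! 1) ` ch z" using y by (auto simp: ch_def)
    next
      fix c assume "c \<in> (\<lambda>y. P y ! 1) ` ch z"
      then obtain y where y: "y \<in> V - {r}" "par y = z" "c = P y ! 1" by (auto simp: ch_def)
      then show "c \<in> ?C" unfolding C using L_bounds[of y] P_0[of y] z by (intro exI[of _ y] exI[of _ 1]) simp
    qed
    moreover have "inj_on (\<lambda>y. P y ! 1) (ch z)"
    proof (rule inj_onI)
      fix y y' assume "y \<in> ch z" "y' \<in> ch z" "P y ! 1 = P y' ! 1"
      moreover have "address (P u ! 1) = (u, 1)" if "u \<in> ch z" for u
        using that L_bounds[of u] chD[of u z] by (intro address_nth) auto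
      ultimately show "y = y'" by (metis fst_conv)
    qed
    moreover have "flowW (P y ! 1) = \<theta> y" if "y \<in> ch z" for y
      using that L_bounds[of y] chD[of y z] by (intro flowW_nth) auto
    ultimately show ?thesis using flow[OF z(1)] flowW_phi[OF z(1)] z(2) by (simp add: sum.reindex)
  next
    case False
    then obtain y j where y: "y \<in> V - {r}" "1 \<le> j" "j \<le> L y" "a = P y ! j"
      using W_cases[OF a] root_in by blast
    then have jL: "j < L y" using False P_L[of y] by (metis DiffD1 image_eqI le_neq_implies_less)
    have "?C = {P y ! Suc j}"
    proof (intro subset_antisym subsetI)
      fix c assume "c \<in> ?C"
      then obtain y' j' where y': "y' \<in> V - {r}" "1 \<le> j'" "j' \<le> L y'" "c = P y' ! j'" "P y' ! (j' - 1) = a"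
        using C by blast
      have "j' \<noteq> 1" using y' P_0[of y'] False par_in by auto
      then have "address a = (y', j' - 1)" using address_nth[of y' "j' - 1"] y' by simp
      then have "y' = y" "j' - 1 = j" using address_nth[of y j] y by auto
      then show "c \<in> {P y ! Suc j}" using y' by auto
    next
      fix c assume "c \<in> {P y ! Suc j}"
      then show "c \<in> ?C" unfolding C using y jL by (intro exI[of _ y] exI[of _ "Suc j"]) simp
    qed
    then show ?thesis using flowW_nth[of y j] flowW_nth[of y "Suc j"] y jL by simp
  qed
qed

lemma flowW_energy:
  assumes F: "finite F" "F \<subseteq> W - {\<phi> r}"
  shows "(\<Sum>a\<in>F. (flowW a)\<^sup>2) \<le> real M * energy"
proof -
  let ?Y = "fst ` address ` F"
  have ad: "address a \<in> addresses \<and> node (address a) = a" if "a \<in> F" for a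
    using that F(2) address_node unfolding W_nodes by auto
  have inj: "inj_on address F" by (metis ad inj_onI)
  have "(\<Sum>a\<in>F. (flowW a)\<^sup>2) = (\<Sum>p\<in>address ` F. (\<theta> (fst p))\<^sup>2)"
    using F(2) inj by (subst sum.reindex) (auto simp: flowW_def intro!: sum.cong)
  also have "\<dots> \<le> (\<Sum>p\<in>?Y \<times> {1..M}. (\<theta> (fst p))\<^sup>2)"
  proof (rule sum_mono2)
    show "address ` F \<subseteq> ?Y \<times> {1..M}"
    proof
      fix p assume p: "p \<in> address ` F"
      then have "p \<in> addresses" using ad by blast
      then have "snd p \<in> {1..M}" using L_bounds[of "fst p"] by (auto simp: addresses_def)
      then show "p \<in> ?Y \<times> {1..M}" using p by (auto simp: mem_Times_iff)
    qed
  qed (use F(1) in auto)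
  also have "\<dots> = real M * (\<Sum>y\<in>?Y. (\<theta> y)\<^sup>2)"
    by (simp add: sum.cartesian_product' sum_distrib_left)
  also have "\<dots> \<le> real M * energy"
    using F(1) ad by (intro mult_left_mono flow_energy) (auto simp: addresses_def, force+)
  finally show ?thesis .
qed

lemma flow_treeW: "flow_tree W adjW (\<phi> r) parW flowW (real M * energy)"
proof -
  interpret W: rooted_tree W adjW "\<phi> r" parW by (rule rooted_treeW)
  show ?thesis
  proof
    show "flowW (\<phi> r) = 1" by (simp add: flowW_def)
    show "(\<Sum>c\<in>W.ch a. flowW c) = flowW a" if "a \<in> W" for a
      using flowW_conservation[OF that] by (simp add: W.ch_def)
    show "0 \<le> flowW a" if "a \<in> W" for a
      using that by (cases rule: W_cases) (simp_all add: flowW_nth flow_nonneg, simp add: flowW_def)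
  qed (rule flowW_energy)
qed

end

lemma (in flow_tree) subdivision_flow_tree:
  assumes sub: "bounded_subdivision V adj W adjW"
  shows "\<exists>r' par' \<theta>' E. flow_tree W adjW r' par' \<theta>' E"
    and "infinite V \<Longrightarrow> infinite W"
proof -
  obtain M where "subdivision_bounded_by M V adj W adjW"
    using sub unfolding bounded_subdivision_def by blast
  then obtain \<phi> p where inj: "inj_on \<phi> V" and phiW: "\<phi> ` V \<subseteq> W"
    and p': "\<forall>x y. adj x y \<longrightarrow>
         2 \<le> length (p x y) \<and> length (p x y) \<le> Suc M \<and>
         hd (p x y) = \<phi> x \<and> last (p x y) = \<phi> y \<and> distinct (p x y) \<and> set (p x y) \<subseteq> W \<and>
         set (butlast (tl (p x y))) \<inter> \<phi> ` V = {} \<and> p y x = rev (p x y)"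
    and disj: "\<forall>x y x' y'. adj x y \<longrightarrow> adj x' y' \<longrightarrow> {x, y} \<noteq> {x', y'} \<longrightarrow>
         set (butlast (tl (p x y))) \<inter> set (butlast (tl (p x' y'))) = {}"
    and adjW: "\<forall>a b. adjW a b \<longleftrightarrow>
         (\<exists>x y i. adj x y \<and> Suc i < length (p x y) \<and> a = p x y ! i \<and> b = p x y ! Suc i)"
    and W: "W = \<phi> ` V \<union> (\<Union>{set (p x y) | x y. adj x y})"
    unfolding subdivision_bounded_by_def by (elim exE conjE) (rule that)
  note p = p'[rule_format] and disj = disj[rule_format] and adjW = adjW[rule_format]
  \<comment> \<open>The subdivision supplies a path for each orientation of an edge; the one
    starting at the parent is kept and the other is its reversal.\<close>
  define P where "P y = p (par y) y" for y
  have pa: "adj (par y) y" if "y \<in> V - {r}" for y using that par_in adj_iff by auto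
  have edge: "(y \<in> V - {r} \<and> x = par y) \<or> (x \<in> V - {r} \<and> y = par x)" if "adj x y" for x y
    using that adj_iff by blast
  have revp: "p x (par x) = rev (P x)" if "x \<in> V - {r}" for x
    using p[OF pa[OF that]] by (simp add: P_def)
  have "subdivided_flow_tree V adj r par \<theta> energy \<phi> P W adjW M"
  proof
    show "inj_on \<phi> V" by fact
    fix y assume y: "y \<in> V - {r}"
    show "2 \<le> length (P y) \<and> length (P y) \<le> Suc M" "hd (P y) = \<phi> (par y) \<and> last (P y) = \<phi> y"
      "distinct (P y)" "set (butlast (tl (P y))) \<inter> \<phi> ` V = {}"
      using p[OF pa[OF y]] by (auto simp: P_def)
    fix z assume z: "z \<in> V - {r}" "y \<noteq> z"
    have "{par y, y} \<noteq> {par z, z}"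
    proof
      assume "{par y, y} = {par z, z}"
      then have "par y = z" "par z = y" using z(2) by (auto simp: doubleton_eq_iff)
      then show False using depth_par[of y] depth_par[of z] y z by auto
    qed
    then show "set (butlast (tl (P y))) \<inter> set (butlast (tl (P z))) = {}"
      unfolding P_def by (intro disj pa y z)
  next
    have "set (p x y) \<subseteq> (\<Union>y\<in>V - {r}. set (P y))" if "adj x y" for x y
      using edge[OF that] revp by (auto simp: P_def)
    moreover have "set (P y) \<subseteq> \<Union>{set (p x y) | x y. adj x y}" if "y \<in> V - {r}" for y
      using pa[OF that] unfolding P_def by blast
    ultimately have "\<Union>{set (p x y) | x y. adj x y} = (\<Union>y\<in>V - {r}. set (P y))" by blast
    then show "W = \<phi> ` V \<union> (\<Union>y\<in>V - {r}. set (P y))" using W by simp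
  next
    fix a b
    show "adjW a b \<longleftrightarrow> (\<exists>y\<in>V - {r}. \<exists>i. Suc i < length (P y) \<and>
      (a = P y ! i \<and> b = P y ! Suc i \<or> b = P y ! i \<and> a = P y ! Suc i))" (is "_ \<longleftrightarrow> ?R")
    proof
      assume "adjW a b"
      then obtain x y i where xy: "adj x y" "Suc i < length (p x y)" "a = p x y ! i" "b = p x y ! Suc i"
        using adjW by blast
      from edge[OF xy(1)] show ?R
      proof
        assume "y \<in> V - {r} \<and> x = par y"
        then show ?R using xy unfolding P_def by blast
      next
        assume x: "x \<in> V - {r} \<and> y = par x"
        define n where "n = length (P x)"
        have pr: "p x y = rev (P x)" using revp x by simp
        then have i: "Suc i < n" using xy(2) by (simp add: n_def)
        have "a = P x ! (n - Suc i)" "b = P x ! (n - Suc (Suc i))"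
          using xy(3,4) i unfolding pr n_def by (simp_all add: rev_nth)
        moreover have "n - Suc i = Suc (n - Suc (Suc i))" using i by simp
        ultimately show ?R using x i by (intro bexI[of _ x] exI[of _ "n - Suc (Suc i)"]) (auto simp: n_def)
      qed
    next
      assume ?R
      then obtain y i where y: "y \<in> V - {r}" "Suc i < length (P y)"
        and ab: "a = P y ! i \<and> b = P y ! Suc i \<or> b = P y ! i \<and> a = P y ! Suc i" by blast
      have ad: "adjW (P y ! i) (P y ! Suc i)"
        unfolding adjW using pa[OF y(1)] y(2) unfolding P_def by blast
      \<comment> \<open>In the reversed path the same edge starts at index
        \<open>n - Suc (Suc i)\<close>.\<close>
      define n where "n = length (P y)"
      have i: "n - Suc (n - Suc (Suc i)) = Suc i" "n - Suc (Suc (n - Suc (Suc i))) = i"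
        "Suc (n - Suc (Suc i)) < n"
        using y(2) by (auto simp: n_def)
      have "adjW (rev (P y) ! (n - Suc (Suc i))) (rev (P y) ! Suc (n - Suc (Suc i)))"
        unfolding adjW revp[OF y(1), symmetric]
        using adj_sym[OF pa[OF y(1)]] i(3) revp[OF y(1)] by (metis length_rev n_def)
      then have "adjW (P y ! Suc i) (P y ! i)"
        using i by (simp add: rev_nth n_def)
      then show "adjW a b" using ab ad by blast
    qed
  qed
  from subdivided_flow_tree.flow_treeW[OF this]
  show "\<exists>r' par' \<theta>' E. flow_tree W adjW r' par' \<theta>' E" by (intro exI)
  show "infinite V \<Longrightarrow> infinite W" using inj phiW finite_subset finite_image_iff by metis
qed

theorem mainTheorem1:
  fixes VT :: "'a set" and adjT :: "'a \<Rightarrow> 'a \<Rightarrow> bool"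
    and V :: "'v set" and adj :: "'v \<Rightarrow> 'v \<Rightarrow> bool"
  assumes "is_tree VT adjT"
    and "infinite VT"
    and "locally_finite_graph VT adjT"
    and "srw_transient VT adjT"
    and "\<forall>x\<in>VT. degree adjT x \<noteq> 2"
    and "bounded_subdivision VT adjT V adj"
  shows "wired_MSA_limit_exists V adj (exp_weights adj)"
proof -
  obtain r where r: "r \<in> VT" using assms(1) by (auto simp: is_tree_def)
  obtain par where "rooted_tree VT adjT r par"
    using rooted_tree_if_tree[OF assms(1,3) r] by blast
  then obtain \<theta> E where T: "flow_tree VT adjT r par \<theta> E"
    using rooted_tree.flow_tree_if_transient[OF _ assms(4,2)] by blast
  obtain r' par' \<theta>' E' where "flow_tree V adj r' par' \<theta>' E'"
    using flow_tree.subdivision_flow_tree(1)[OF T assms(6)] by blast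
  then show ?thesis
    by (rule flow_tree.wired_limit_exists) (rule flow_tree.subdivision_flow_tree(2)[OF T assms(6,2)])
qed

end
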